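(* Let $m\in\mathbb{N}_0$ and $n\in\mathbb{N}$ with $m+1<n$, let $\mu$ be a radial weight on the unit disk $\mathbb{D}$, let $\psi_1,\psi_2$ be analytic functions on $\mathbb{D}$, and let $\varphi:\mathbb{D}\to\mathbb{D}$ be analytic. Define $$(T^{m,n}_{\psi_1,\psi_2,\varphi}f)(z)=\psi_1(z)f^{(m)}(\varphi(z))+\psi_2(z)f^{(n)}(\varphi(z)),\qquad z\in\mathbb{D},$$ and $$E_m=\psi_1',\qquad E_{m+1}=\psi_1\varphi',\qquad E_n=\psi_2',\qquad E_{n+1}=\psi_2\varphi'.$$ Suppose that $T^{m,n}_{\psi_1,\psi_2,\varphi}:H^\infty\to\mathcal{B}_\mu$ is bounded. Then $$\|T^{m,n}_{\psi_1,\psi_2,\varphi}\|_{e,H^\infty\to\mathcal{B}_\mu}\approx\max_{i\in\{m,m+1,n,n+1\}}\Big\{\limsup_{|\varphi(z)|\to1}\frac{\mu(z)|E_i(z)|}{(1-|\varphi(z)|^2)^i}\Big\}\approx\max_{1\le i\le4}\Big\{\limsup_{|\varphi(w)|\to1}\|T^{m,n}_{\psi_1,\psi_2,\varphi}f_{i,\varphi(w)}\|_{\mathcal{B}_\mu}\Big\},$$ where $f_{i,\varphi(w)}(z)=\Big(\dfrac{1-|\varphi(w)|}{1-\overline{\varphi(w)}z}\Big)^i$ for $w,z\in\mathbb{D}$.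
   Context: $\mathbb{D}=\{z\in\mathbb{C}:|z|<1\}$, $\mathbb{N}_0=\{0,1,2,\dots\}$, $\mathbb{N}=\{1,2,\dots\}$. $H^\infty$ is the space of bounded analytic functions on $\mathbb{D}$ with norm $\|f\|_\infty=\sup_{z\in\mathbb{D}}|f(z)|$. A radial weight is a positive continuous function $\mu$ on $\mathbb{D}$ with $\mu(z)=\mu(|z|)$. The weighted Bloch space $\mathcal{B}_\mu$ is the space of analytic $f$ on $\mathbb{D}$ with $\|f\|_{\mathcal{B}_\mu}=|f(0)|+\sup_{z\in\mathbb{D}}\mu(z)|f'(z)|<\infty$. Essential norm: for a bounded linear operator $T:X\to Y$, $\|T\|_{e,X\to Y}=\inf\{\|T-L\|_{X\to Y}: L:X\to Y \text{ compact linear}\}$, where $\|S\|_{X\to Y}=\sup_{\|f\|_X\le1}\|Sf\|_Y$. $A\approx B$ means that there is a constant $C>0$ with $C^{-1}B\le A\le CB$; here $C$ does not depend on $\psi_1,\psi_2,\varphi$. The notation $\limsup_{|\varphi(z)|\to1}F(z)$ means $\lim_{\delta\to1^-}\sup\{F(z): z\in\mathbb{D},\ |\varphi(z)|>\delta\}$, interpreted as $0$ if $\sup_{z\in\mathbb{D}}|\varphi(z)|<1$. *)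

theory Defs
  imports "HOL-Analysis.Analysis"
begin

abbreviation disk :: "complex set" where
  "disk \<equiv> ball 0 1"

text \<open>A function on the unit disk is encoded as a total function that vanishes off the disk, so
  that equality of elements of a function space is equality of functions on the disk.\<close>

definition on_disk :: "(complex \<Rightarrow> complex) \<Rightarrow> complex \<Rightarrow> complex" where
  "on_disk f = (\<lambda>z. if z \<in> disk then f z else 0)"

definition disk_analytic :: "(complex \<Rightarrow> complex) set" where
  "disk_analytic = {f. f holomorphic_on disk \<and> (\<forall>z. z \<notin> disk \<longrightarrow> f z = 0)}"

text \<open>All norms take values in the extended nonnegative reals, so suprema need no boundedness
  side condition.\<close>

definition Hinf_norm :: "(complex \<Rightarrow> complex) \<Rightarrow> ennreal" where
  "Hinf_norm f = (SUP z\<in>disk. ennreal (cmod (f z)))"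

definition Hinf :: "(complex \<Rightarrow> complex) set" where
  "Hinf = {f \<in> disk_analytic. Hinf_norm f < \<infinity>}"

definition radial_weight :: "(complex \<Rightarrow> real) \<Rightarrow> bool" where
  "radial_weight \<mu> \<longleftrightarrow>
     continuous_on disk \<mu> \<and> (\<forall>z\<in>disk. \<mu> z > 0 \<and> \<mu> z = \<mu> (of_real (cmod z)))"

definition Bloch_norm :: "(complex \<Rightarrow> real) \<Rightarrow> (complex \<Rightarrow> complex) \<Rightarrow> ennreal" where
  "Bloch_norm \<mu> f = ennreal (cmod (f 0)) + (SUP z\<in>disk. ennreal (\<mu> z * cmod (deriv f z)))"

definition Bloch :: "(complex \<Rightarrow> real) \<Rightarrow> (complex \<Rightarrow> complex) set" where
  "Bloch \<mu> = {f \<in> disk_analytic. Bloch_norm \<mu> f < \<infinity>}"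

text \<open>Operators between two function spaces, each given by its carrier \<open>X\<close>, \<open>Y\<close> and its norm
  \<open>nX\<close>, \<open>nY\<close>. Only the values of an operator on \<open>X\<close> matter.\<close>

type_synonym operator = "(complex \<Rightarrow> complex) \<Rightarrow> complex \<Rightarrow> complex"

definition linear_operator ::
  "(complex \<Rightarrow> complex) set \<Rightarrow> (complex \<Rightarrow> complex) set \<Rightarrow> operator \<Rightarrow> bool" where
  "linear_operator X Y L \<longleftrightarrow>
     (\<forall>f\<in>X. L f \<in> Y) \<and>
     (\<forall>f\<in>X. \<forall>g\<in>X. L (\<lambda>z. f z + g z) = (\<lambda>z. L f z + L g z)) \<and>
     (\<forall>c. \<forall>f\<in>X. L (\<lambda>z. c * f z) = (\<lambda>z. c * L f z))"

definition op_norm ::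
  "(complex \<Rightarrow> complex) set \<Rightarrow> ((complex \<Rightarrow> complex) \<Rightarrow> ennreal) \<Rightarrow>
   ((complex \<Rightarrow> complex) \<Rightarrow> ennreal) \<Rightarrow> operator \<Rightarrow> ennreal" where
  "op_norm X nX nY S = (SUP f\<in>{f \<in> X. nX f \<le> 1}. nY (S f))"

definition bounded_operator ::
  "(complex \<Rightarrow> complex) set \<Rightarrow> ((complex \<Rightarrow> complex) \<Rightarrow> ennreal) \<Rightarrow>
   (complex \<Rightarrow> complex) set \<Rightarrow> ((complex \<Rightarrow> complex) \<Rightarrow> ennreal) \<Rightarrow> operator \<Rightarrow> bool" where
  "bounded_operator X nX Y nY S \<longleftrightarrow> linear_operator X Y S \<and> op_norm X nX nY S < \<infinity>"

definition norm_topology ::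
  "(complex \<Rightarrow> complex) set \<Rightarrow> ((complex \<Rightarrow> complex) \<Rightarrow> ennreal) \<Rightarrow>
   (complex \<Rightarrow> complex) topology" where
  "norm_topology Y nY = Metric_space.mtopology Y (\<lambda>f g. enn2real (nY (\<lambda>z. f z - g z)))"

definition compact_operator ::
  "(complex \<Rightarrow> complex) set \<Rightarrow> ((complex \<Rightarrow> complex) \<Rightarrow> ennreal) \<Rightarrow>
   (complex \<Rightarrow> complex) set \<Rightarrow> ((complex \<Rightarrow> complex) \<Rightarrow> ennreal) \<Rightarrow> operator \<Rightarrow> bool" where
  "compact_operator X nX Y nY L \<longleftrightarrow>
     linear_operator X Y L \<and>
     compactin (norm_topology Y nY) (norm_topology Y nY closure_of (L ` {f \<in> X. nX f \<le> 1}))"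

definition essential_norm ::
  "(complex \<Rightarrow> complex) set \<Rightarrow> ((complex \<Rightarrow> complex) \<Rightarrow> ennreal) \<Rightarrow>
   (complex \<Rightarrow> complex) set \<Rightarrow> ((complex \<Rightarrow> complex) \<Rightarrow> ennreal) \<Rightarrow> operator \<Rightarrow> ennreal" where
  "essential_norm X nX Y nY S =
     (INF L\<in>{L. compact_operator X nX Y nY L}. op_norm X nX nY (\<lambda>f z. S f z - L f z))"

definition T_op ::
  "nat \<Rightarrow> nat \<Rightarrow> (complex \<Rightarrow> complex) \<Rightarrow> (complex \<Rightarrow> complex) \<Rightarrow> (complex \<Rightarrow> complex) \<Rightarrow> operator"
where
  "T_op m n \<psi>1 \<psi>2 \<phi> f =
     on_disk (\<lambda>z. \<psi>1 z * (deriv ^^ m) f (\<phi> z) + \<psi>2 z * (deriv ^^ n) f (\<phi> z))"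

text \<open>For \<open>m + 1 < n\<close> the four indices below are distinct; the value at other indices is never
  used.\<close>

definition E_fun ::
  "nat \<Rightarrow> nat \<Rightarrow> (complex \<Rightarrow> complex) \<Rightarrow> (complex \<Rightarrow> complex) \<Rightarrow> (complex \<Rightarrow> complex) \<Rightarrow>
   nat \<Rightarrow> complex \<Rightarrow> complex"
where
  "E_fun m n \<psi>1 \<psi>2 \<phi> i z =
     (if i = m then deriv \<psi>1 z
      else if i = m + 1 then \<psi>1 z * deriv \<phi> z
      else if i = n then deriv \<psi>2 z
      else if i = n + 1 then \<psi>2 z * deriv \<phi> z
      else 0)"

definition f_test :: "nat \<Rightarrow> complex \<Rightarrow> complex \<Rightarrow> complex" where
  "f_test i a = on_disk (\<lambda>z. ((1 - of_real (cmod a)) / (1 - cnj a * z)) ^ i)"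

text \<open>The upper limit as \<open>\<bar>\<phi>(z)\<bar> \<rightarrow> 1\<close>. If \<open>\<bar>\<phi>\<bar>\<close> is bounded away from \<open>1\<close> on the disk, the
  supremum is eventually over the empty set, hence \<open>0\<close> in \<^typ>\<open>ennreal\<close>, and so is the limit.\<close>

definition limsup_to_bdry ::
  "(complex \<Rightarrow> complex) \<Rightarrow> (complex \<Rightarrow> ennreal) \<Rightarrow> ennreal" where
  "limsup_to_bdry \<phi> F = Lim (at_left (1::real)) (\<lambda>\<delta>. SUP z\<in>{z \<in> disk. cmod (\<phi> z) > \<delta>}. F z)"

definition comparable :: "real \<Rightarrow> ennreal \<Rightarrow> ennreal \<Rightarrow> bool" where
  "comparable C A B \<longleftrightarrow> ennreal (inverse C) * B \<le> A \<and> A \<le> ennreal C * B"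

end

theory Submission
  imports Defs "HOL-Complex_Analysis.Complex_Analysis"
begin

text \<open>
  The derivative of \<open>T f\<close> at \<open>z\<close> is the sum of \<open>E\<^sub>k(z) f\<^sup>(\<^sup>k\<^sup>)(\<phi>(z))\<close> over the four orders \<open>k\<close>, and
  Cauchy's estimate bounds \<open>(1 - |w|\<^sup>2)\<^sup>k |f\<^sup>(\<^sup>k\<^sup>)(w)|\<close> for \<open>|f| \<le> 1\<close>. So if \<open>f\<close> is small on a large
  compact disk, \<open>T f\<close> is controlled by the weighted sizes of the \<open>E\<^sub>k\<close> near the boundary alone. Applied
  to the test functions this bounds their images; applied to \<open>f\<close> minus a Taylor polynomial of a
  dilation of \<open>f\<close> it bounds the essential norm, because the polynomial part has finite rank.

  Conversely, evaluating the images of the four test functions at \<open>w\<close> gives a linear system with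
  an invertible Vandermonde-type matrix for the weighted values of the \<open>E\<^sub>k\<close>. For the
  essential norm, take functions \<open>h\<^sub>j\<close> with a prescribed jet at \<open>\<phi>(z\<^sub>j) \<rightarrow> \<zeta>\<close>, \<open>|\<zeta>| = 1\<close>. If \<open>L\<close> is compact,
  some subsequence of \<open>L h\<^sub>j\<close> is Cauchy, so \<open>T - L\<close> is tested against differences \<open>h\<^sub>j - h\<^sub>l\<close>.
  The \<open>h\<^sub>j\<close> need not tend weakly to zero in the space of bounded analytic functions, but
  for fixed \<open>l\<close> the contribution of \<open>h\<^sub>l\<close> at \<open>z\<^sub>j\<close> vanishes in the limit once \<open>h\<^sub>l(\<zeta>) = 0\<close>.
\<close>

section \<open>Upper limits at the boundary\<close>

text \<open>The supremum decreases as \<open>\<delta>\<close> grows, so its left limit at 1 exists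
  and is the infimum. Thus \<open>Lim\<close> denotes a genuine limit here, and later arguments only
  handle infima.\<close>

lemma limsup_to_bdry_eq_INF:
  "limsup_to_bdry \<phi> F = (INF \<delta>\<in>{..<1::real}. SUP z\<in>{z \<in> disk. cmod (\<phi> z) > \<delta>}. F z)"
proof -
  define S where "S \<delta> = (SUP z\<in>{z \<in> disk. cmod (\<phi> z) > \<delta>}. F z)" for \<delta> :: real
  have anti: "S \<delta>' \<le> S \<delta>" if "\<delta> \<le> \<delta>'" for \<delta> \<delta>'
    unfolding S_def using that by (intro SUP_subset_mono) auto
  have "(S \<longlongrightarrow> (INF \<delta>\<in>{..<1}. S \<delta>)) (at_left 1)"
  proof (rule order_tendstoI)
    fix a assume a: "a < (INF \<delta>\<in>{..<1}. S \<delta>)"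
    have "eventually (\<lambda>\<delta>::real. \<delta> < 1) (at_left 1)"
      by (simp add: eventually_at_filter)
    then show "eventually (\<lambda>\<delta>. a < S \<delta>) (at_left 1)"
      by eventually_elim (use a in \<open>auto intro: less_le_trans INF_lower\<close>)
  next
    fix a assume "(INF \<delta>\<in>{..<1}. S \<delta>) < a"
    then obtain \<delta>0 where "\<delta>0 < 1" "S \<delta>0 < a"
      by (auto simp: INF_less_iff)
    then have "eventually (\<lambda>\<delta>. \<delta> > \<delta>0) (at_left 1)"
      by (auto intro: eventually_at_leftI[of \<delta>0])
    then show "eventually (\<lambda>\<delta>. S \<delta> < a) (at_left 1)"
      by eventually_elim (rule le_less_trans[OF anti \<open>S \<delta>0 < a\<close>], simp)
  qed
  then show ?thesis
    unfolding limsup_to_bdry_def S_def by (intro tendsto_Lim) auto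
qed

lemma limsup_to_bdry_lessD:
  assumes "limsup_to_bdry \<phi> F < c"
  obtains \<delta> where "\<delta> < 1" "\<And>z. z \<in> disk \<Longrightarrow> cmod (\<phi> z) > \<delta> \<Longrightarrow> F z \<le> c"
proof -
  from assms obtain \<delta> where \<delta>: "\<delta> < 1" "(SUP z\<in>{z \<in> disk. cmod (\<phi> z) > \<delta>}. F z) < c"
    unfolding limsup_to_bdry_eq_INF INF_less_iff by auto
  show thesis
  proof (rule that)
    show "F z \<le> c" if "z \<in> disk" "cmod (\<phi> z) > \<delta>" for z
    proof -
      have "F z \<le> (SUP z\<in>{z \<in> disk. cmod (\<phi> z) > \<delta>}. F z)"
        using that by (intro SUP_upper) auto
      then show ?thesis using \<delta>(2) by (rule order.trans[OF _ less_imp_le])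
    qed
  qed (fact \<delta>(1))
qed

lemma limsup_to_bdry_greaterD:
  assumes "c < limsup_to_bdry \<phi> F" "\<delta> < 1"
  obtains z where "z \<in> disk" "cmod (\<phi> z) > \<delta>" "c < F z"
proof -
  have "c < (SUP z\<in>{z \<in> disk. cmod (\<phi> z) > \<delta>}. F z)"
    using assms unfolding limsup_to_bdry_eq_INF by (auto intro: less_le_trans INF_lower)
  then show thesis using that unfolding less_SUP_iff by auto
qed

lemma limsup_to_bdry_le:
  assumes "\<delta> < 1" "\<And>z. z \<in> disk \<Longrightarrow> cmod (\<phi> z) > \<delta> \<Longrightarrow> F z \<le> c"
  shows "limsup_to_bdry \<phi> F \<le> c"
  unfolding limsup_to_bdry_eq_INF
  by (rule INF_lower2[of \<delta>]) (use assms in \<open>auto intro!: SUP_least\<close>)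

section \<open>Inequalities between extended nonnegative quantities\<close>

text \<open>An upper limit yields pointwise bounds only for real thresholds strictly above it, and
  this lemma passes back from such thresholds. For finite \<open>Q\<close> take
  \<open>c = Q + e / C\<close> and let \<open>e\<close> tend to 0; for infinite \<open>Q\<close> the
  right side is infinite.\<close>

lemma le_ennreal_mult_if_above:
  assumes "C > 0" "\<And>c::real. c > 0 \<Longrightarrow> Q < ennreal c \<Longrightarrow> M \<le> ennreal (C * c)"
  shows "M \<le> ennreal C * Q"
proof (cases Q)
  case (real q)
  show ?thesis
  proof (rule ennreal_le_epsilon)
    fix e :: real assume "e > 0"
    have "M \<le> ennreal (C * (q + e / C))"
      using real \<open>e > 0\<close> \<open>C > 0\<close> by (intro assms(2)) (auto simp: add_nonneg_pos ennreal_less_iff)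
    also have "C * (q + e / C) = C * q + e"
      using \<open>C > 0\<close> by (simp add: field_simps)
    also have "ennreal (C * q + e) = ennreal C * Q + ennreal e"
      using real \<open>C > 0\<close> \<open>e > 0\<close> by (simp add: ennreal_mult ennreal_plus)
    finally show "M \<le> ennreal C * Q + ennreal e" .
  qed
next
  case top
  then show ?thesis using assms(1) by (simp add: ennreal_mult_top)
qed

lemma comparableI:
  assumes "C > 0" "B \<le> ennreal C * A" "A \<le> ennreal C * B"
  shows "comparable C A B"
proof -
  have "ennreal (inverse C) * B \<le> ennreal (inverse C) * (ennreal C * A)"
    by (intro mult_left_mono assms) auto
  also have "\<dots> = A"
    using assms(1) by (simp add: mult.assoc[symmetric] ennreal_mult[symmetric])
  finally show ?thesis
    using assms(3) by (simp add: comparable_def)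
qed

section \<open>The weighted Bloch space\<close>

locale bloch_weight =
  fixes \<mu> :: "complex \<Rightarrow> real"
  assumes weight: "radial_weight \<mu>"
begin

lemma weight_pos: "z \<in> disk \<Longrightarrow> \<mu> z > 0"
  using weight unfolding radial_weight_def by blast

lemma Bloch_norm_le:
  assumes "0 \<le> y" "cmod (f 0) \<le> x" "\<And>z. z \<in> disk \<Longrightarrow> \<mu> z * cmod (deriv f z) \<le> y"
  shows "Bloch_norm \<mu> f \<le> ennreal (x + y)"
proof -
  have "x \<ge> 0" using assms(2) norm_ge_zero order.trans by blast
  then show ?thesis unfolding Bloch_norm_def ennreal_plus[OF \<open>x \<ge> 0\<close> assms(1)]
    by (intro add_mono SUP_least ennreal_leI assms) 
qed

lemma Bloch_norm_leD:
  assumes "Bloch_norm \<mu> f \<le> ennreal x" "x \<ge> 0"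
  shows "cmod (f 0) \<le> x" "z \<in> disk \<Longrightarrow> \<mu> z * cmod (deriv f z) \<le> x"
proof -
  have "ennreal (cmod (f 0)) \<le> ennreal x"
    by (rule order.trans[OF _ assms(1)]) (simp add: Bloch_norm_def)
  then show "cmod (f 0) \<le> x" using assms(2) by (simp add: ennreal_le_iff)
  assume z: "z \<in> disk"
  have "ennreal (\<mu> z * cmod (deriv f z)) \<le> (SUP z\<in>disk. ennreal (\<mu> z * cmod (deriv f z)))"
    using z by (rule SUP_upper)
  also have "\<dots> \<le> Bloch_norm \<mu> f" by (simp add: Bloch_norm_def)
  also note assms(1)
  finally show "\<mu> z * cmod (deriv f z) \<le> x" using assms(2) by (simp add: ennreal_le_iff)
qed

lemma disk_analytic_field_differentiable:
  "f \<in> disk_analytic \<Longrightarrow> z \<in> disk \<Longrightarrow> f field_differentiable at z"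
  unfolding disk_analytic_def by (auto intro: holomorphic_on_imp_differentiable_at)

lemma Bloch_norm_add_le:
  assumes "f \<in> disk_analytic" "g \<in> disk_analytic"
  shows "Bloch_norm \<mu> (\<lambda>z. f z + g z) \<le> Bloch_norm \<mu> f + Bloch_norm \<mu> g"
proof -
  let ?S = "\<lambda>f. (SUP z\<in>disk. ennreal (\<mu> z * cmod (deriv f z)))"
  have "?S (\<lambda>z. f z + g z) \<le> ?S f + ?S g"
  proof (rule SUP_least)
    fix z assume z: "z \<in> disk"
    have "deriv (\<lambda>z. f z + g z) z = deriv f z + deriv g z"
      using z assms by (intro deriv_add disk_analytic_field_differentiable)
    then have "\<mu> z * cmod (deriv (\<lambda>z. f z + g z) z)
        \<le> \<mu> z * cmod (deriv f z) + \<mu> z * cmod (deriv g z)"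
      using weight_pos[OF z] by (simp add: norm_triangle_ineq distrib_left[symmetric])
    then have "ennreal (\<mu> z * cmod (deriv (\<lambda>z. f z + g z) z))
        \<le> ennreal (\<mu> z * cmod (deriv f z)) + ennreal (\<mu> z * cmod (deriv g z))"
      using weight_pos[OF z] by (simp add: ennreal_leI flip: ennreal_plus)
    also have "\<dots> \<le> ?S f + ?S g"
      using z by (intro add_mono SUP_upper)
    finally show "ennreal (\<mu> z * cmod (deriv (\<lambda>z. f z + g z) z)) \<le> ?S f + ?S g" .
  qed
  moreover have "ennreal (cmod (f 0 + g 0)) \<le> ennreal (cmod (f 0)) + ennreal (cmod (g 0))"
    by (simp add: ennreal_leI norm_triangle_ineq flip: ennreal_plus)
  ultimately have "Bloch_norm \<mu> (\<lambda>z. f z + g z)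
      \<le> (ennreal (cmod (f 0)) + ennreal (cmod (g 0))) + (?S f + ?S g)"
    unfolding Bloch_norm_def by (rule add_mono[rotated])
  then show ?thesis
    by (simp add: Bloch_norm_def add_ac)
qed

lemma Bloch_norm_cmult:
  assumes "f \<in> disk_analytic"
  shows "Bloch_norm \<mu> (\<lambda>z. c * f z) = ennreal (cmod c) * Bloch_norm \<mu> f"
proof -
  have "(SUP z\<in>disk. ennreal (\<mu> z * cmod (deriv (\<lambda>z. c * f z) z)))
      = (SUP z\<in>disk. ennreal (cmod c) * ennreal (\<mu> z * cmod (deriv f z)))"
  proof (rule SUP_cong)
    fix z assume z: "z \<in> disk"
    have "deriv (\<lambda>z. c * f z) z = c * deriv f z"
      using z assms by (intro deriv_cmult disk_analytic_field_differentiable)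
    then show "ennreal (\<mu> z * cmod (deriv (\<lambda>z. c * f z) z))
        = ennreal (cmod c) * ennreal (\<mu> z * cmod (deriv f z))"
      using weight_pos[OF z] by (simp add: norm_mult ennreal_mult[symmetric] mult_ac)
  qed simp
  then show ?thesis
    by (simp add: Bloch_norm_def SUP_mult_left_ennreal distrib_left norm_mult ennreal_mult)
qed

lemma disk_analytic_add: "f \<in> disk_analytic \<Longrightarrow> g \<in> disk_analytic \<Longrightarrow> (\<lambda>z. f z + g z) \<in> disk_analytic"
  and disk_analytic_cmult: "f \<in> disk_analytic \<Longrightarrow> (\<lambda>z. c * f z) \<in> disk_analytic"
  by (auto simp: disk_analytic_def intro!: holomorphic_intros)

lemma Bloch_disk_analytic: "f \<in> Bloch \<mu> \<Longrightarrow> f \<in> disk_analytic"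
  by (simp add: Bloch_def)

lemma Bloch_add: "f \<in> Bloch \<mu> \<Longrightarrow> g \<in> Bloch \<mu> \<Longrightarrow> (\<lambda>z. f z + g z) \<in> Bloch \<mu>"
  using Bloch_norm_add_le[of f g]
  by (auto simp: Bloch_def disk_analytic_add ennreal_add_eq_top less_top[symmetric] top_unique)

lemma Bloch_cmult: "f \<in> Bloch \<mu> \<Longrightarrow> (\<lambda>z. c * f z) \<in> Bloch \<mu>"
  by (auto simp: Bloch_def disk_analytic_cmult Bloch_norm_cmult ennreal_mult_less_top)

lemma Bloch_diff: "f \<in> Bloch \<mu> \<Longrightarrow> g \<in> Bloch \<mu> \<Longrightarrow> (\<lambda>z. f z - g z) \<in> Bloch \<mu>"
  using Bloch_add[of f "\<lambda>z. - 1 * g z"] Bloch_cmult[of g "-1"] by simp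

lemma Bloch_zero: "(\<lambda>_. 0) \<in> Bloch \<mu>"
  using Bloch_norm_le[of 0 "\<lambda>_. 0" 0] by (auto simp: Bloch_def disk_analytic_def)

text \<open>\<open>enn2real\<close> sends infinity to 0, so this real version, made for the metric,
  is a norm only on \<open>Bloch \<mu>\<close>.\<close>

definition bnorm :: "(complex \<Rightarrow> complex) \<Rightarrow> real" where
  "bnorm f = enn2real (Bloch_norm \<mu> f)"

lemma ennreal_bnorm: "f \<in> Bloch \<mu> \<Longrightarrow> ennreal (bnorm f) = Bloch_norm \<mu> f"
  by (simp add: Bloch_def bnorm_def less_top[symmetric])

lemma bnorm_nonneg: "bnorm f \<ge> 0"
  by (simp add: bnorm_def)

lemma bnorm_cmult: "f \<in> disk_analytic \<Longrightarrow> bnorm (\<lambda>z. c * f z) = cmod c * bnorm f"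
  by (simp add: bnorm_def Bloch_norm_cmult enn2real_mult)

lemma bnorm_add_le:
  assumes "f \<in> Bloch \<mu>" "g \<in> Bloch \<mu>"
  shows "bnorm (\<lambda>z. f z + g z) \<le> bnorm f + bnorm g"
proof -
  have "ennreal (bnorm (\<lambda>z. f z + g z)) \<le> ennreal (bnorm f) + ennreal (bnorm g)"
    using Bloch_norm_add_le[of f g] assms
    by (simp add: ennreal_bnorm Bloch_add Bloch_disk_analytic)
  then show ?thesis by (simp add: bnorm_nonneg flip: ennreal_plus)
qed

text \<open>Positivity of the weight forces a zero derivative, so \<open>f\<close> is constant on
  the disk, and its value at 0 is 0. Vanishing off the disk turns this into equality of total
  functions.\<close>

lemma bnorm_eq_0_iff:
  assumes "f \<in> Bloch \<mu>"
  shows "bnorm f = 0 \<longleftrightarrow> f = (\<lambda>_. 0)"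
proof
  assume "bnorm f = 0"
  then have *: "Bloch_norm \<mu> f \<le> ennreal 0"
    using ennreal_bnorm[OF assms] by simp
  have f: "f holomorphic_on disk" "\<And>z. z \<notin> disk \<Longrightarrow> f z = 0"
    using Bloch_disk_analytic[OF assms] by (auto simp: disk_analytic_def)
  have d0: "deriv f z = 0" if "z \<in> disk" for z
    using Bloch_norm_leD(2)[OF * order.refl that] weight_pos[OF that]
    by (simp add: mult_le_0_iff)
  have "\<exists>c. \<forall>z\<in>disk. f z = c"
  proof (rule has_field_derivative_zero_constant)
    show "(f has_field_derivative 0) (at z within disk)" if "z \<in> disk" for z
      using holomorphic_derivI[OF f(1) _ that, of disk] d0[OF that] by simp
  qed simp
  then obtain c where c: "\<And>z. z \<in> disk \<Longrightarrow> f z = c" by auto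
  moreover have "f 0 = 0" using Bloch_norm_leD(1)[OF *] by simp
  ultimately have "c = 0" by force
  then show "f = (\<lambda>_. 0)" using c f(2) by blast
next
  assume "f = (\<lambda>_. 0)"
  then show "bnorm f = 0" by (simp add: bnorm_def Bloch_norm_def)
qed

definition bdist :: "(complex \<Rightarrow> complex) \<Rightarrow> (complex \<Rightarrow> complex) \<Rightarrow> real" where
  "bdist f g = bnorm (\<lambda>z. f z - g z)"

lemma norm_topology_Bloch: "norm_topology (Bloch \<mu>) (Bloch_norm \<mu>) = Metric_space.mtopology (Bloch \<mu>) bdist"
  by (simp add: norm_topology_def bdist_def[abs_def] bnorm_def)

sublocale Metric_space "Bloch \<mu>" bdist
proof
  fix f g h
  show "bdist f g \<ge> 0" by (simp add: bdist_def bnorm_nonneg)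
  \<comment> \<open>The metric axioms demand symmetry for all functions, not only those in
    \<open>Bloch \<mu>\<close>. Where no derivative exists, both sides are the same default value of
    \<open>deriv\<close>, a choice from an empty predicate.\<close>
  have d: "cmod (deriv (\<lambda>z. f z - g z) z) = cmod (deriv (\<lambda>z. g z - f z) z)" for z
  proof -
    have eq: "DERIV (\<lambda>z. f z - g z) z :> D \<longleftrightarrow> DERIV (\<lambda>z. g z - f z) z :> - D" for D
      using DERIV_minus[of "\<lambda>z. f z - g z" D z UNIV] DERIV_minus[of "\<lambda>z. g z - f z" "- D" z UNIV] by auto
    show ?thesis
    proof (cases "\<exists>D. DERIV (\<lambda>z. f z - g z) z :> D")
      case True
      then obtain D where D: "DERIV (\<lambda>z. f z - g z) z :> D" by blast
      then have "DERIV (\<lambda>z. g z - f z) z :> - D" using eq by blast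
      then show ?thesis using D by (simp add: DERIV_imp_deriv)
    next
      case False
      then have "\<nexists>D. DERIV (\<lambda>z. g z - f z) z :> D" using eq by (metis minus_minus)
      then show ?thesis using False by (simp add: deriv_def)
    qed
  qed
  show "bdist f g = bdist g f"
    by (simp add: bdist_def bnorm_def Bloch_norm_def d norm_minus_commute[of "f 0"])
  assume f: "f \<in> Bloch \<mu>" and g: "g \<in> Bloch \<mu>"
  show "bdist f g = 0 \<longleftrightarrow> f = g"
    using bnorm_eq_0_iff[OF Bloch_diff[OF f g]] by (auto simp: bdist_def fun_eq_iff)
  assume h: "h \<in> Bloch \<mu>"
  show "bdist f h \<le> bdist f g + bdist g h"
    using bnorm_add_le[OF Bloch_diff[OF f g] Bloch_diff[OF g h]] by (simp add: bdist_def)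
qed

section \<open>Compact sets and compact operators in the Bloch metric\<close>

text \<open>Sequential compactness with two nested subsequences: the first makes the coefficients
  converge in the closed unit disk, the second the components in \<open>K\<close>.\<close>

lemma compactin_add_disc_multiples:
  assumes K: "compactin mtopology K" and g: "g \<in> Bloch \<mu>"
  shows "compactin mtopology {\<lambda>z. k z + c * g z | k c. k \<in> K \<and> cmod c \<le> 1}" (is "compactin _ ?S")
  unfolding compactin_sequentially
proof (intro conjI allI impI)
  have KB: "K \<subseteq> Bloch \<mu>" using K by (simp add: compactin_sequentially)
  have mem: "(\<lambda>z. k z + c * g z) \<in> Bloch \<mu>" if "k \<in> K" for k c
    using Bloch_add[of k "\<lambda>z. c * g z"] Bloch_cmult[OF g] KB that by auto
  then show "?S \<subseteq> Bloch \<mu>" by auto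
  fix \<sigma> :: "nat \<Rightarrow> complex \<Rightarrow> complex"
  assume "range \<sigma> \<subseteq> ?S"
  then have "\<forall>i. \<exists>k c. k \<in> K \<and> cmod c \<le> 1 \<and> \<sigma> i = (\<lambda>z. k z + c * g z)" by blast
  then obtain k where "\<forall>i. \<exists>c. k i \<in> K \<and> cmod c \<le> 1 \<and> \<sigma> i = (\<lambda>z. k i z + c * g z)"
    by (rule choice[THEN exE])
  then obtain c where "\<forall>i. k i \<in> K \<and> cmod (c i) \<le> 1 \<and> \<sigma> i = (\<lambda>z. k i z + c i * g z)"
    by (rule choice[THEN exE])
  then have kc: "\<And>i. k i \<in> K" "\<And>i. cmod (c i) \<le> 1" "\<And>i. \<sigma> i = (\<lambda>z. k i z + c i * g z)"
    by blast+
  have "\<forall>i. c i \<in> cball 0 1" using kc(2) by simp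
  then obtain r c0 where r: "strict_mono r" "(c \<circ> r) \<longlonglongrightarrow> c0" "c0 \<in> cball 0 1"
    using compact_cball[of "0::complex" 1] unfolding compact_def by blast
  have "range (k \<circ> r) \<subseteq> K" using kc(1) by auto
  then obtain k0 r' where r': "k0 \<in> K" "strict_mono r'" "limitin mtopology ((k \<circ> r) \<circ> r') k0 sequentially"
    using K unfolding compactin_sequentially by blast
  define l where "l = (\<lambda>z. k0 z + c0 * g z)"
  have k0: "k0 \<in> Bloch \<mu>" using r'(1) KB by blast
  have kB: "k i \<in> Bloch \<mu>" for i using kc(1) KB by blast
  have "limitin mtopology (\<sigma> \<circ> (r \<circ> r')) l sequentially"
    unfolding limitin_metric
  proof (intro conjI allI impI)
    show "l \<in> Bloch \<mu>" using mem[OF r'(1)] by (simp add: l_def)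
    fix \<epsilon> :: real assume "\<epsilon> > 0"
    have "(\<lambda>i. cmod (c (r (r' i)) - c0) * bnorm g) \<longlonglongrightarrow> 0 * bnorm g"
      using LIMSEQ_subseq_LIMSEQ[OF r(2) r'(2)]
      by (intro tendsto_intros) (simp add: o_def tendsto_norm_zero LIM_zero)
    then have "eventually (\<lambda>i. cmod (c (r (r' i)) - c0) * bnorm g < \<epsilon> / 2) sequentially"
      using \<open>\<epsilon> > 0\<close> by (intro order_tendstoD) auto
    moreover have "eventually (\<lambda>i. bdist (k (r (r' i))) k0 < \<epsilon> / 2) sequentially"
      using r'(3) \<open>\<epsilon> > 0\<close> unfolding limitin_metric by (auto elim!: eventually_mono dest!: spec[of _ "\<epsilon> / 2"])
    ultimately show "eventually (\<lambda>i. (\<sigma> \<circ> (r \<circ> r')) i \<in> Bloch \<mu> \<and> bdist ((\<sigma> \<circ> (r \<circ> r')) i) l < \<epsilon>) sequentially"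
    proof eventually_elim
      case (elim i)
      let ?j = "r (r' i)"
      have "bdist (\<sigma> ?j) l = bnorm (\<lambda>z. (k ?j z - k0 z) + (c ?j - c0) * g z)"
        by (simp add: bdist_def kc(3) l_def algebra_simps)
      also have "\<dots> \<le> bnorm (\<lambda>z. k ?j z - k0 z) + bnorm (\<lambda>z. (c ?j - c0) * g z)"
        by (intro bnorm_add_le Bloch_diff Bloch_cmult kB k0 g)
      also have "\<dots> = bdist (k ?j) k0 + cmod (c ?j - c0) * bnorm g"
        by (simp add: bdist_def bnorm_cmult Bloch_disk_analytic g)
      also have "\<dots> < \<epsilon>" using elim by simp
      finally show ?case using mem[OF kc(1)] by (simp add: kc(3))
    qed
  qed
  moreover have "l \<in> ?S"
    unfolding l_def mem_Collect_eq using r'(1) r(3) by (intro exI conjI) (rule refl, simp_all)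
  moreover have "strict_mono (r \<circ> r')" using r(1) r'(2) by (rule strict_mono_o)
  ultimately show "\<exists>l r. l \<in> ?S \<and> strict_mono r \<and> limitin mtopology (\<sigma> \<circ> r) l sequentially"
    by (intro exI conjI)
qed

text \<open>Induction on the number of generators, starting from the compact set containing only the
  zero function. These sets will contain the unit ball images of finite-rank operators.\<close>

lemma compactin_unit_combinations:
  fixes g :: "nat \<Rightarrow> complex \<Rightarrow> complex"
  assumes g: "\<And>j. g j \<in> Bloch \<mu>"
  shows "compactin mtopology {\<lambda>z. \<Sum>j<N. c j * g j z | c. \<forall>j<N. cmod (c j) \<le> 1}"
proof (induction N)
  case 0
  have "{\<lambda>z. \<Sum>j<0. c j * g j z | c. \<forall>j<0. cmod (c j) \<le> 1} = {\<lambda>_. 0}"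
    by auto
  moreover have "compactin mtopology {\<lambda>_. 0}"
    using Bloch_zero by (intro finite_imp_compactin) simp_all
  ultimately show ?case by (simp only:)
next
  case (Suc N)
  let ?K = "\<lambda>N. {\<lambda>z. \<Sum>j<N. c j * g j z | c. \<forall>j<N. cmod (c j) \<le> 1}"
  have "?K (Suc N) = {\<lambda>z. k z + c * g N z | k c. k \<in> ?K N \<and> cmod c \<le> 1}"
  proof (intro equalityI subsetI)
    fix f assume "f \<in> {\<lambda>z. k z + c * g N z | k c. k \<in> ?K N \<and> cmod c \<le> 1}"
    then obtain b c where bc: "\<forall>j<N. cmod (b j) \<le> 1" "cmod c \<le> 1"
      and f: "f = (\<lambda>z. (\<Sum>j<N. b j * g j z) + c * g N z)" by auto
    have "f = (\<lambda>z. \<Sum>j<Suc N. (b(N := c)) j * g j z)" unfolding f by (auto intro!: sum.cong)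
    then show "f \<in> ?K (Suc N)" using bc by (intro CollectI exI[of _ "b(N := c)"]) (auto simp: less_Suc_eq)
  next
    fix f assume "f \<in> ?K (Suc N)"
    then obtain c where c: "\<forall>j<Suc N. cmod (c j) \<le> 1" "f = (\<lambda>z. \<Sum>j<Suc N. c j * g j z)" by blast
    define k where "k = (\<lambda>z. \<Sum>j<N. c j * g j z)"
    have "k \<in> ?K N" "cmod (c N) \<le> 1" using c(1) by (auto simp: k_def)
    moreover have "f = (\<lambda>z. k z + c N * g N z)" using c(2) by (simp add: k_def)
    ultimately show "f \<in> {\<lambda>z. k z + c * g N z | k c. k \<in> ?K N \<and> cmod c \<le> 1}"
      unfolding mem_Collect_eq by (intro exI[of _ k] exI[of _ "c N"] conjI)
  qed
  then show ?case using compactin_add_disc_multiples[OF Suc.IH g[of N]] by simp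
qed

text \<open>In a metric space \<open>K\<close> is closed, so it contains the closure of the image,
  and a closed subset of a compact set is compact.\<close>

lemma compact_operator_if_image_subset:
  assumes "linear_operator X (Bloch \<mu>) L" "compactin mtopology K" "L ` {f \<in> X. nX f \<le> 1} \<subseteq> K"
  shows "compact_operator X nX (Bloch \<mu>) (Bloch_norm \<mu>) L"
proof -
  have "mtopology closure_of (L ` {f \<in> X. nX f \<le> 1}) \<subseteq> K"
    using assms Hausdorff_space_mtopology by (intro closure_of_minimal compactin_imp_closedin)
  then show ?thesis
    using assms closed_compactin[OF assms(2)]
    by (simp add: compact_operator_def norm_topology_Bloch)
qed

text \<open>The images lie in a compact closure, so a subsequence converges and is Cauchy by the
  triangle inequality. The Cauchy form suits testing on differences of the \<open>h j\<close>, where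
  the limit itself is of no interest.\<close>

lemma compact_operator_subseq:
  assumes L: "compact_operator X nX (Bloch \<mu>) (Bloch_norm \<mu>) L"
    and h: "\<And>j::nat. h j \<in> X" "\<And>j. nX (h j) \<le> 1"
  obtains r :: "nat \<Rightarrow> nat" where "strict_mono r"
    "\<And>e. e > 0 \<Longrightarrow> \<exists>N. \<forall>i\<ge>N. \<forall>j\<ge>N. bnorm (\<lambda>z. L (h (r i)) z - L (h (r j)) z) < e"
proof -
  let ?S = "L ` {f \<in> X. nX f \<le> 1}"
  have comp: "compactin mtopology (mtopology closure_of ?S)" and lin: "linear_operator X (Bloch \<mu>) L"
    using L by (auto simp: compact_operator_def norm_topology_Bloch)
  have "?S \<subseteq> Bloch \<mu>" using lin by (auto simp: linear_operator_def)
  then have "?S \<subseteq> mtopology closure_of ?S" by (intro closure_of_subset) simp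
  then have "range (L \<circ> h) \<subseteq> mtopology closure_of ?S" using h by auto
  then obtain l r where r: "strict_mono r" "limitin mtopology ((L \<circ> h) \<circ> r) l sequentially"
    using comp unfolding compactin_sequentially by blast
  show thesis
  proof (rule that[OF r(1)])
    fix e :: real assume "e > 0"
    then obtain N where N: "\<And>i. i \<ge> N \<Longrightarrow> L (h (r i)) \<in> Bloch \<mu> \<and> bdist (L (h (r i))) l < e / 2"
      using r(2) unfolding limit_metric_sequentially by (metis comp_apply half_gt_zero)
    have l: "l \<in> Bloch \<mu>" using r(2) unfolding limit_metric_sequentially by blast
    have "bdist (L (h (r i))) (L (h (r j))) < e" if "i \<ge> N" "j \<ge> N" for i j
      using triangle[of "L (h (r i))" l "L (h (r j))"] N[OF that(1)] N[OF that(2)] l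
      by (simp add: commute)
    then show "\<exists>N. \<forall>i\<ge>N. \<forall>j\<ge>N. bnorm (\<lambda>z. L (h (r i)) z - L (h (r j)) z) < e"
      unfolding bdist_def by blast
  qed
qed

end

section \<open>Bounded analytic functions\<close>

text \<open>Cauchy's inequality on the circle about \<open>w\<close> whose radius \<open>r\<close>
  is half the distance to the unit circle. The factor \<open>4 ^ k\<close> comes from
  \<open>1 - (cmod w)\<^sup>2 \<le> 2 * (1 - cmod w) = 4 * r\<close>.\<close>

lemma higher_deriv_weighted_bound:
  assumes f: "f holomorphic_on disk" "\<And>z. z \<in> disk \<Longrightarrow> cmod (f z) \<le> 1" and w: "w \<in> disk"
  shows "cmod ((deriv ^^ k) f w) * (1 - (cmod w)\<^sup>2) ^ k \<le> fact k * 4 ^ k"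
proof -
  define r where "r = (1 - cmod w) / 2"
  have w1: "cmod w < 1" using w by simp
  then have r: "r > 0" by (simp add: r_def)
  have sub: "cball w r \<subseteq> disk"
    using w1 by (auto simp: subset_iff r_def cball_def dist_norm) (smt (verit) norm_triangle_sub norm_minus_commute field_sum_of_halves)
  have "cmod ((deriv ^^ k) f w) \<le> fact k * 1 / r ^ k"
  proof (rule Cauchy_inequality[OF _ _ r])
    show "f holomorphic_on ball w r" "continuous_on (cball w r) f"
      by (rule holomorphic_on_subset[OF f(1) order.trans[OF ball_subset_cball sub]])
        (rule holomorphic_on_imp_continuous_on[OF holomorphic_on_subset[OF f(1) sub]])
    show "cmod (f x) \<le> 1" if "cmod (w - x) = r" for x
      using that sub by (intro f(2)) (auto simp: subset_iff dist_norm)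
  qed
  moreover have "(1 - (cmod w)\<^sup>2) ^ k \<le> (4 * r) ^ k"
  proof (rule power_mono)
    have "1 - (cmod w)\<^sup>2 = (1 - cmod w) * (1 + cmod w)" by (simp add: power2_eq_square algebra_simps)
    also have "\<dots> \<le> (1 - cmod w) * 2" using w1 by (intro mult_left_mono) auto
    finally show "1 - (cmod w)\<^sup>2 \<le> 4 * r" by (simp add: r_def)
    show "0 \<le> 1 - (cmod w)\<^sup>2" using w1 by (simp add: abs_square_le_1)
  qed
  ultimately have "cmod ((deriv ^^ k) f w) * (1 - (cmod w)\<^sup>2) ^ k \<le> (fact k * 1 / r ^ k) * (4 * r) ^ k"
    using r w1 by (intro mult_mono) (auto simp: abs_square_le_1)
  also have "\<dots> = fact k * 4 ^ k" using r by (simp add: power_mult_distrib)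
  finally show ?thesis .
qed

text \<open>The circle of radius \<open>\<rho> - \<delta>\<close> about \<open>w\<close> stays where
  \<open>f\<close> is bounded by \<open>\<eta>\<close>. So smallness on a compact disk passes to all
  derivatives on a smaller one.\<close>

lemma higher_deriv_bound_inside:
  assumes f: "f holomorphic_on disk" "\<And>z. cmod z \<le> \<rho> \<Longrightarrow> cmod (f z) \<le> \<eta>"
    and "\<delta> < \<rho>" "\<rho> < 1" "cmod w \<le> \<delta>"
  shows "cmod ((deriv ^^ k) f w) \<le> fact k * \<eta> / (\<rho> - \<delta>) ^ k"
proof (rule Cauchy_inequality)
  have sub: "cmod x \<le> \<rho>" if "cmod (w - x) \<le> \<rho> - \<delta>" for x
    using that assms(5) norm_triangle_sub[of x w] by (simp add: norm_minus_commute)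
  have cb: "cball w (\<rho> - \<delta>) \<subseteq> disk" using sub assms(4) by (fastforce simp: dist_norm)
  show "f holomorphic_on ball w (\<rho> - \<delta>)" "continuous_on (cball w (\<rho> - \<delta>)) f"
    by (rule holomorphic_on_subset[OF f(1) order.trans[OF ball_subset_cball cb]])
      (rule holomorphic_on_imp_continuous_on[OF holomorphic_on_subset[OF f(1) cb]])
  show "cmod (f x) \<le> \<eta>" if "cmod (w - x) = \<rho> - \<delta>" for x
    using that by (intro f(2) sub) simp
qed (use assms in simp)

text \<open>Each term of Leibniz' formula contains a derivative of \<open>(z - a) ^ M\<close> of
  order below \<open>M\<close>, which is zero at \<open>a\<close>.\<close>

lemma higher_deriv_diff_power_times:
  assumes G: "G holomorphic_on S" "open S" "a \<in> S" and "i < M"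
  shows "(deriv ^^ i) (\<lambda>z. (z - a) ^ M * G z) a = 0"
proof -
  have "(deriv ^^ i) (\<lambda>z. (z - a) ^ M * G z) a =
      (\<Sum>j = 0..i. of_nat (i choose j) * (deriv ^^ j) (\<lambda>z. (z - a) ^ M) a * (deriv ^^ (i - j)) G a)"
    by (rule higher_deriv_mult[of _ S]) (use G in \<open>auto intro!: holomorphic_intros\<close>)
  also have "\<dots> = 0"
    using assms(4) by (intro sum.neutral ballI) (simp add: higher_deriv_power)
  finally show ?thesis .
qed

section \<open>Blaschke factors and functions with a prescribed jet\<close>

lemma one_minus_cnj_mult_neq_0:
  assumes "cmod a < 1" "cmod z \<le> 1"
  shows "1 - cnj a * z \<noteq> 0"
proof
  assume "1 - cnj a * z = 0"
  then have "cmod (cnj a * z) = 1" by simp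
  moreover have "cmod (cnj a * z) \<le> cmod a * 1"
    unfolding norm_mult using assms by (intro mult_mono) auto
  ultimately show False using assms(1) by simp
qed

text \<open>This compares the denominator and the numerator of a Blaschke factor. The right side is
  nonnegative on the closed disk and zero for \<open>cmod z = 1\<close>, which gives the bound by 1
  inside and modulus 1 on the circle.\<close>

lemma norm_one_minus_cnj_mult_sq:
  "(cmod (1 - cnj a * z))\<^sup>2 - (cmod (a - z))\<^sup>2 = (1 - (cmod a)\<^sup>2) * (1 - (cmod z)\<^sup>2)"
  unfolding cmod_power2 by (simp add: power2_eq_square algebra_simps)

lemma norm_Blaschke_le_1:
  assumes "cmod a < 1" "cmod z \<le> 1"
  shows "cmod ((a - z) / (1 - cnj a * z)) \<le> 1"
proof -
  have "0 \<le> (1 - (cmod a)\<^sup>2) * (1 - (cmod z)\<^sup>2)"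
    using assms by (simp add: abs_square_le_1)
  then have "(cmod (a - z))\<^sup>2 \<le> (cmod (1 - cnj a * z))\<^sup>2"
    using norm_one_minus_cnj_mult_sq[of a z] by linarith
  then have "cmod (a - z) \<le> cmod (1 - cnj a * z)"
    by (rule power2_le_imp_le) simp
  then show ?thesis by (simp add: norm_divide divide_le_eq_1)
qed

lemma norm_Blaschke_eq_1:
  assumes "cmod a < 1" "cmod z = 1"
  shows "cmod ((a - z) / (1 - cnj a * z)) = 1"
proof -
  have "(cmod (a - z))\<^sup>2 = (cmod (1 - cnj a * z))\<^sup>2"
    using norm_one_minus_cnj_mult_sq[of a z] assms by simp
  then have "cmod (a - z) = cmod (1 - cnj a * z)"
    by (simp add: power2_eq_iff_nonneg)
  then show ?thesis using one_minus_cnj_mult_neq_0[of a z] assms by (simp add: norm_divide)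
qed

text \<open>With \<open>s = (a - z) / (1 - cnj a z)\<close> and \<open>t = (z - a) / (1 - |a|\<^sup>2)\<close> one has \<open>t = - s / (1 - cnj a s)\<close>.
  Truncating the geometric series turns \<open>t\<^sup>k\<close> into a polynomial in \<open>s\<close>, bounded on the disk, with
  the same jet at \<open>a\<close>; the factor \<open>1 - (s / s(\<zeta>))\<^sup>M\<close> makes it vanish at \<open>\<zeta>\<close> and keeps the jet.\<close>

lemma ex_jet_function:
  assumes a: "cmod a < 1" and \<zeta>: "cmod \<zeta> = 1" and M: "M > 0"
  obtains h where "h holomorphic_on {z. 1 - cnj a * z \<noteq> 0}" "h \<zeta> = 0"
    "\<And>z. cmod z < 1 \<Longrightarrow> cmod (h z) \<le> 2 * real M ^ k"
    "\<And>i. i < M \<Longrightarrow> (deriv ^^ i) h a = (if i = k then fact k / of_real (1 - (cmod a)\<^sup>2) ^ k else 0)"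
proof -
  define S where "S = {z. 1 - cnj a * z \<noteq> 0}"
  define c where "c = complex_of_real (1 - (cmod a)\<^sup>2)"
  define b where "b z = (a - z) / (1 - cnj a * z)" for z
  define \<beta> where "\<beta> = b \<zeta>"
  define h where "h z = (- b z * (\<Sum>j<M. (cnj a * b z) ^ j)) ^ k * (1 - (b z / \<beta>) ^ M)" for z
  have openS: "open S"
    unfolding S_def by (intro open_Collect_neq continuous_intros)
  have aS: "a \<in> S" using a one_minus_cnj_mult_neq_0[of a a] by (simp add: S_def)
  have c0: "c \<noteq> 0" using a by (simp add: c_def abs_square_eq_1 del: of_real_diff)
  have \<beta>: "cmod \<beta> = 1" using norm_Blaschke_eq_1[OF a \<zeta>] by (simp add: \<beta>_def b_def)
  then have \<beta>0: "\<beta> \<noteq> 0" by auto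
  have b_le: "cmod (b z) \<le> 1" if "cmod z < 1" for z
    using norm_Blaschke_le_1[of a z] a that by (simp add: b_def)
  have holb: "b holomorphic_on S" unfolding b_def S_def by (intro holomorphic_intros) auto
  then have holh: "h holomorphic_on S" unfolding h_def using \<beta>0 by (intro holomorphic_intros) auto
  have h\<zeta>: "h \<zeta> = 0" using \<beta>0 by (simp add: h_def \<beta>_def)
  have h_le: "cmod (h z) \<le> 2 * real M ^ k" if z: "cmod z < 1" for z
  proof -
    have "cmod (\<Sum>j<M. (cnj a * b z) ^ j) \<le> (\<Sum>j<M. 1)"
      using a b_le[OF z] by (intro sum_norm_le) (auto simp: norm_power norm_mult intro!: power_le_one mult_le_one)
    then have "cmod (- b z * (\<Sum>j<M. (cnj a * b z) ^ j)) \<le> 1 * real M"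
      unfolding norm_mult using b_le[OF z] by (intro mult_mono) auto
    then have "cmod ((- b z * (\<Sum>j<M. (cnj a * b z) ^ j)) ^ k) \<le> real M ^ k"
      unfolding norm_power by (intro power_mono) auto
    moreover have "cmod (1 - (b z / \<beta>) ^ M) \<le> 1 + 1"
      using \<beta> b_le[OF z] by (intro order.trans[OF norm_triangle_ineq4] add_mono)
        (auto simp: norm_power norm_divide intro!: power_le_one)
    ultimately have "cmod (h z) \<le> real M ^ k * (1 + 1)"
      unfolding h_def norm_mult[of "_ ^ k"] by (intro mult_mono) auto
    then show ?thesis by simp
  qed
  \<comment> \<open>\<open>R\<close> is the cofactor in \<open>(1 - x) ^ k = 1 - x * R z\<close> for
    \<open>x = (cnj a * b z) ^ M\<close>. Every correction to the main term
    \<open>((z - a) / c) ^ k\<close> thus carries \<open>b z ^ M\<close>, hence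
    \<open>(z - a) ^ M\<close>; \<open>G\<close> collects the remaining relative factor.\<close>
  define R where "R z = (\<Sum>j<k. (1 - (cnj a * b z) ^ M) ^ j)" for z
  define G where "G z = - (((-1) / (1 - cnj a * z)) ^ M * (1 / \<beta> ^ M + cnj a ^ M * R z * (1 - (b z / \<beta>) ^ M)))" for z
  have holG: "G holomorphic_on S"
    unfolding G_def R_def using \<beta>0 holb by (intro holomorphic_intros) (auto simp: S_def)
  have h_eq: "h z = ((z - a) / c) ^ k + (z - a) ^ M * (((z - a) / c) ^ k * G z)" if z: "z \<in> S" for z
  proof -
    have nz: "1 - cnj a * z \<noteq> 0" using z by (simp add: S_def)
    have c_eq: "c = 1 - cnj a * a" by (simp add: c_def mult.commute complex_norm_square del: of_real_power)
    have ab: "1 - cnj a * b z = c / (1 - cnj a * z)"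
      using nz by (simp add: b_def c_eq field_simps)
    \<comment> \<open>The truncated geometric series is \<open>1 / (1 - cnj a * b z)\<close> up to
      the factor \<open>1 - (cnj a * b z) ^ M\<close>, and \<open>ab\<close> makes this reciprocal
      explicit.\<close>
    have "(1 - cnj a * b z) * (\<Sum>j<M. (cnj a * b z) ^ j) = 1 - (cnj a * b z) ^ M"
      using one_diff_power_eq[of "cnj a * b z" M] by simp
    then have sum_eq: "(\<Sum>j<M. (cnj a * b z) ^ j) = (1 - (cnj a * b z) ^ M) * ((1 - cnj a * z) / c)"
      using nz c0 by (simp add: ab field_simps)
    have "- b z * (\<Sum>j<M. (cnj a * b z) ^ j) = (z - a) / c * (1 - (cnj a * b z) ^ M)"
      unfolding sum_eq using nz c0 by (simp add: b_def field_simps)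
    then have h1: "h z = ((z - a) / c) ^ k * ((1 - (cnj a * b z) ^ M) ^ k * (1 - (b z / \<beta>) ^ M))"
      by (simp only: h_def power_mult_distrib mult.assoc)
    have R: "(1 - (cnj a * b z) ^ M) ^ k = 1 - (cnj a * b z) ^ M * R z"
    proof -
      have gen: "x = 1 - y" if "1 - x = y" for x y :: complex by (simp add: that[symmetric])
      show ?thesis using one_diff_power_eq[of "1 - (cnj a * b z) ^ M" k] by (intro gen) (simp add: R_def)
    qed
    have bM: "b z ^ M = (z - a) ^ M * ((-1) / (1 - cnj a * z)) ^ M"
    proof -
      have "b z = (z - a) * ((-1) / (1 - cnj a * z))" using nz by (simp add: b_def field_simps)
      then show ?thesis by (simp only: power_mult_distrib)
    qed
    have "(1 - (cnj a * b z) ^ M) ^ k * (1 - (b z / \<beta>) ^ M)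
        = 1 - b z ^ M * (1 / \<beta> ^ M + cnj a ^ M * R z * (1 - (b z / \<beta>) ^ M))"
      unfolding R by (simp add: power_mult_distrib power_divide algebra_simps)
    also have "\<dots> = 1 + (z - a) ^ M * G z"
      unfolding bM by (simp add: G_def algebra_simps)
    finally have factor_eq: "(1 - (cnj a * b z) ^ M) ^ k * (1 - (b z / \<beta>) ^ M) = 1 + (z - a) ^ M * G z" .
    show ?thesis unfolding h1 factor_eq by (simp add: algebra_simps)
  qed
  have "(deriv ^^ i) h a = (if i = k then fact k / of_real (1 - (cmod a)\<^sup>2) ^ k else 0)" if i: "i < M" for i
  proof -
    let ?p = "\<lambda>z. (1 / c ^ k) * (z - a) ^ k" and ?q = "\<lambda>z. (z - a) ^ M * (((z - a) / c) ^ k * G z)"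
    have hp: "?p holomorphic_on S" and hq: "?q holomorphic_on S"
      using c0 holG by (auto intro!: holomorphic_intros)
    have "(deriv ^^ i) h a = (deriv ^^ i) (\<lambda>z. ?p z + ?q z) a"
      using holh hp hq openS aS h_eq
      by (intro higher_deriv_transform_within_open[of _ S]) (auto simp: power_divide intro!: holomorphic_on_add)
    also have "\<dots> = (deriv ^^ i) ?p a + (deriv ^^ i) ?q a"
      by (rule higher_deriv_add[OF hp hq openS aS])
    also have "(deriv ^^ i) ?q a = 0"
      using c0 holG openS aS i by (intro higher_deriv_diff_power_times[of _ S]) (auto intro!: holomorphic_intros)
    also have "(deriv ^^ i) ?p a = 1 / c ^ k * (deriv ^^ i) (\<lambda>z. (z - a) ^ k) a"
      by (rule higher_deriv_cmult[of _ UNIV]) (auto intro!: holomorphic_intros)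
    also have "(deriv ^^ i) (\<lambda>z. (z - a) ^ k) a = (if i = k then fact k else 0)"
    proof (cases "i < k")
      case False
      show ?thesis
      proof (cases "i = k")
        case True
        then show ?thesis by (simp add: higher_deriv_power pochhammer_fact)
      next
        \<comment> \<open>For \<open>i > k\<close> the truncated difference \<open>Suc k - i\<close>
          is 0, and the rising factorial of 0 of positive length vanishes.\<close>
        assume "i \<noteq> k"
        with False have "Suc k - i = 0" "i > 0" by auto
        then show ?thesis using \<open>i \<noteq> k\<close> by (simp add: higher_deriv_power pochhammer_0_left)
      qed
    qed (simp add: higher_deriv_power)
    finally show ?thesis by (simp add: c_def)
  qed
  then show thesis using that holh h\<zeta> h_le unfolding S_def by blast
qed

section \<open>The test functions and their derivatives\<close>

text \<open>Differentiating the power \<open>- (i + k)\<close> of \<open>1 - cnj a * z\<close>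
  brings down \<open>(i + k) * cnj a\<close>; these factors accumulate to the rising factorial of
  \<open>i\<close>.\<close>

lemma higher_deriv_test_power:
  assumes "cmod a < 1" "cmod z < 1"
  shows "(deriv ^^ k) (\<lambda>z. (c / (1 - cnj a * z)) ^ i) z
    = pochhammer (of_nat i) k * cnj a ^ k * c ^ i / (1 - cnj a * z) ^ (i + k)"
  using assms(2)
proof (induction k arbitrary: z)
  case 0
  then show ?case by (simp add: power_divide)
next
  case (Suc k)
  let ?D = "\<lambda>z. pochhammer (of_nat i) k * cnj a ^ k * c ^ i / (1 - cnj a * z) ^ (i + k)"
  have nz: "1 - cnj a * z \<noteq> 0" if "cmod z < 1" for z
    using one_minus_cnj_mult_neq_0[OF assms(1)] that by simp
  have "eventually (\<lambda>z. z \<in> disk) (nhds z)"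
    using Suc.prems by (intro eventually_nhds_in_open) auto
  then have "deriv ((deriv ^^ k) (\<lambda>z. (c / (1 - cnj a * z)) ^ i)) z = deriv ?D z"
    by (intro deriv_cong_ev refl) (auto elim!: eventually_mono simp: Suc.IH)
  also have "deriv ?D z = pochhammer (of_nat i) (Suc k) * cnj a ^ Suc k * c ^ i / (1 - cnj a * z) ^ (i + Suc k)"
  proof (rule DERIV_imp_deriv)
    let ?A = "pochhammer (of_nat i) k * cnj a ^ k * c ^ i"
    have der: "(?D has_field_derivative
        ?A * (- (inverse ((1 - cnj a * z) ^ (i + k)) * (of_nat (i + k) * (1 - cnj a * z) ^ (i + k - 1) * (- cnj a)) * inverse ((1 - cnj a * z) ^ (i + k))))) (at z)"
      unfolding divide_inverse using nz[OF Suc.prems]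
      by (auto intro!: derivative_eq_intros simp del: of_nat_add)
    have "?A * (- (inverse (u ^ (i + k)) * (of_nat (i + k) * u ^ (i + k - 1) * (- cnj a)) * inverse (u ^ (i + k))))
        = pochhammer (of_nat i) (Suc k) * cnj a ^ Suc k * c ^ i / u ^ (i + Suc k)" if "u \<noteq> 0" for u
    \<comment> \<open>The case 0 is separate because the exponent \<open>i + k - 1\<close> is a
      truncated difference.\<close>
    proof (cases "i + k")
      case 0
      then show ?thesis by (simp add: pochhammer_Suc)
    next
      case (Suc l)
      have "of_nat i + of_nat k = (of_nat (Suc l) :: complex)" using Suc by (metis of_nat_add)
      then show ?thesis using that Suc by (simp add: pochhammer_Suc field_simps)
    qed
    from DERIV_cong[OF der this[OF nz[OF Suc.prems]]]
    show "(?D has_field_derivative pochhammer (of_nat i) (Suc k) * cnj a ^ Suc k * c ^ i / (1 - cnj a * z) ^ (i + Suc k)) (at z)" .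
  qed
  finally show ?case by simp
qed

lemma higher_deriv_on_disk:
  assumes "f holomorphic_on disk" "w \<in> disk"
  shows "(deriv ^^ k) (on_disk f) w = (deriv ^^ k) f w"
proof (rule higher_deriv_transform_within_open[OF _ assms(1) open_ball assms(2)])
  show "on_disk f holomorphic_on disk"
    using assms(1) by (rule holomorphic_transform) (simp add: on_disk_def)
qed (simp add: on_disk_def)

lemma on_disk_Hinf:
  assumes "f holomorphic_on disk" "\<And>z. z \<in> disk \<Longrightarrow> cmod (f z) \<le> B" "B \<ge> 0"
  shows "on_disk f \<in> Hinf" "Hinf_norm (on_disk f) \<le> ennreal B"
proof -
  show *: "Hinf_norm (on_disk f) \<le> ennreal B"
    unfolding Hinf_norm_def by (intro SUP_least ennreal_leI) (simp add: on_disk_def assms(2))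
  have "on_disk f holomorphic_on disk"
    using assms(1) by (rule holomorphic_transform) (simp add: on_disk_def)
  then show "on_disk f \<in> Hinf"
    using * by (auto simp: Hinf_def disk_analytic_def on_disk_def less_top[symmetric] top_unique)
qed

lemma HinfD:
  assumes "f \<in> Hinf"
  shows "f holomorphic_on disk" "on_disk f = f"
  using assms by (auto simp: Hinf_def disk_analytic_def on_disk_def fun_eq_iff)

lemma Hinf_norm_le_1D:
  assumes "Hinf_norm f \<le> 1" "z \<in> disk"
  shows "cmod (f z) \<le> 1"
proof -
  have "ennreal (cmod (f z)) \<le> Hinf_norm f"
    unfolding Hinf_norm_def using assms(2) by (rule SUP_upper)
  then show ?thesis using assms(1) by (metis ennreal_le_1 order.trans)
qed

text \<open>All bounds rest on \<open>cmod (1 - cnj a * z) \<ge> 1 - cmod a * cmod z\<close>. The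
  third claim shows, for \<open>i > 0\<close>, that the test functions become uniformly small on
  compact subdisks as \<open>cmod a\<close> tends to 1.\<close>

lemma f_test_Hinf:
  assumes "cmod a < 1"
  shows "f_test i a \<in> Hinf" "Hinf_norm (f_test i a) \<le> 1"
    and "w \<in> disk \<Longrightarrow> cmod (f_test i a w) \<le> ((1 - cmod a) / (1 - cmod w)) ^ i"
    and "w \<in> disk \<Longrightarrow> (deriv ^^ k) (f_test i a) w
      = pochhammer (of_nat i) k * cnj a ^ k * (1 - of_real (cmod a)) ^ i / (1 - cnj a * w) ^ (i + k)"
proof -
  let ?f = "\<lambda>z. ((1 - of_real (cmod a)) / (1 - cnj a * z)) ^ i"
  have nz: "1 - cnj a * z \<noteq> 0" if "cmod z < 1" for z
    using one_minus_cnj_mult_neq_0[OF assms] that by simp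
  have hol: "?f holomorphic_on disk"
    using nz by (auto intro!: holomorphic_intros)
  have c: "cmod (1 - of_real (cmod a)) = 1 - cmod a"
    using assms by (metis abs_of_nonneg diff_ge_0_iff_ge less_imp_le norm_of_real of_real_1 of_real_diff)
  have lower: "1 - cmod a * cmod z \<le> cmod (1 - cnj a * z)" for z
    using norm_triangle_ineq2[of 1 "cnj a * z"] by (simp add: norm_mult)
  have bound: "cmod (?f z) \<le> ((1 - cmod a) / (1 - cmod a * cmod z)) ^ i" if "cmod z < 1" for z
  proof -
    have "cmod a * cmod z \<le> 1 * cmod z" using assms by (intro mult_right_mono) auto
    then have "0 < 1 - cmod a * cmod z" using that by linarith
    then show ?thesis unfolding norm_power norm_divide c
      using assms lower[of z] by (intro power_mono frac_le) auto
  qed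
  have "cmod (?f z) \<le> 1" if "z \<in> disk" for z
  proof -
    have "cmod a * cmod z \<le> cmod a * 1" using that by (intro mult_left_mono) auto
    then have "((1 - cmod a) / (1 - cmod a * cmod z)) ^ i \<le> 1"
      using assms by (intro power_le_one) (auto simp: divide_le_eq_1)
    then show ?thesis using bound[of z] that by simp
  qed
  from on_disk_Hinf[OF hol this] show "f_test i a \<in> Hinf" "Hinf_norm (f_test i a) \<le> 1"
    by (simp_all add: f_test_def)
  show "cmod (f_test i a w) \<le> ((1 - cmod a) / (1 - cmod w)) ^ i" if "w \<in> disk"
  proof -
    have "cmod a * cmod w \<le> 1 * cmod w" using assms by (intro mult_right_mono) auto
    then have "((1 - cmod a) / (1 - cmod a * cmod w)) ^ i \<le> ((1 - cmod a) / (1 - cmod w)) ^ i"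
      using assms that by (intro power_mono frac_le) auto
    then show ?thesis using bound[of w] that by (simp add: f_test_def on_disk_def)
  qed
  show "(deriv ^^ k) (f_test i a) w
      = pochhammer (of_nat i) k * cnj a ^ k * (1 - of_real (cmod a)) ^ i / (1 - cnj a * w) ^ (i + k)" if "w \<in> disk"
    unfolding f_test_def higher_deriv_on_disk[OF hol that]
    using that by (intro higher_deriv_test_power[OF assms]) simp
qed

text \<open>As a function of \<open>k\<close>, \<open>pochhammer i k / fact k\<close> is the binomial coefficient
  \<open>k + i - 1 choose i - 1\<close>, so for \<open>i = 1, \<dots>, 4\<close> these functions span the cubic polynomials, and
  the required combination is a multiple of \<open>(x - p) (x - q) (x - r)\<close>.\<close>

lemma pochhammer_combination:
  fixes k p q r :: nat
  assumes "k \<noteq> p" "k \<noteq> q" "k \<noteq> r"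
  shows "\<exists>d :: nat \<Rightarrow> real. (\<Sum>i=1..4. d i * pochhammer (real i) k) = 1 \<and>
    (\<forall>l\<in>{p, q, r}. (\<Sum>i=1..4. d i * pochhammer (real i) l) = 0)"
proof -
  have poch: "pochhammer 1 l = fact l" "pochhammer 2 l = fact l * (real l + 1)"
    "pochhammer 3 l = fact l * ((real l + 1) * (real l + 2) / 2)"
    "pochhammer 4 l = fact l * ((real l + 1) * (real l + 2) * (real l + 3) / 6)" for l
    by (induction l) (simp_all add: pochhammer_Suc field_simps)
  \<comment> \<open>Newton interpolation of the cubic at the nodes -1, -2, -3. The basis polynomials
    are exactly the factors in \<open>poch\<close>; the last coefficient 6 makes the cubic
    monic.\<close>
  have newton: "(x - u) * (x - v) * (x - w) = (-1 - u) * (-1 - v) * (-1 - w)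
      + ((-1 - u) * (-1 - v) * (-1 - w) - (-2 - u) * (-2 - v) * (-2 - w)) * (x + 1)
      + ((-1 - u) * (-1 - v) * (-1 - w) - 2 * ((-2 - u) * (-2 - v) * (-2 - w)) + (-3 - u) * (-3 - v) * (-3 - w))
        * ((x + 1) * (x + 2) / 2) + 6 * ((x + 1) * (x + 2) * (x + 3) / 6)" for x u v w :: real
    by (simp add: field_simps)
  have combine: "a / D * F + b / D * (F * A) + c / D * (F * B) + g / D * (F * C) = (a + b * A + c * B + g * C) * (F / D)"
    for a b c g A B C D F :: real
    by (simp add: add_divide_distrib algebra_simps)
  \<comment> \<open>\<open>e t\<close> is the value at \<open>-t\<close> of the cubic with roots
    \<open>p\<close>, \<open>q\<close>, \<open>r\<close>, and \<open>N\<close> is its value at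
    \<open>k\<close>. Dividing the Newton coefficients by \<open>fact k * N\<close> normalises the
    combination to 1 at \<open>k\<close>.\<close>
  define e where "e t = (-t - real p) * (-t - real q) * (-t - real r)" for t
  define N where "N = (real k - real p) * (real k - real q) * (real k - real r)"
  have N0: "N \<noteq> 0" using assms by (simp add: N_def)
  define d :: "nat \<Rightarrow> real" where "d i = (if i = 1 then e 1 else if i = 2 then e 1 - e 2
     else if i = 3 then e 1 - 2 * e 2 + e 3 else 6) / (fact k * N)" for i
  have set4: "{1..4} = {1, 2, 3, 4::nat}" by auto
  have "(\<Sum>i=1..4. d i * pochhammer (real i) l)
    = (real l - real p) * (real l - real q) * (real l - real r) * (fact l / (fact k * N))" for l
  proof -
    have "(\<Sum>i=1..4. d i * pochhammer (real i) l)
      = d 1 * pochhammer 1 l + d 2 * pochhammer 2 l + d 3 * pochhammer 3 l + d 4 * pochhammer 4 l"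
      (is "_ = ?S")
      unfolding set4 by simp
    also have "?S = (e 1 + (e 1 - e 2) * (real l + 1) + (e 1 - 2 * e 2 + e 3) * ((real l + 1) * (real l + 2) / 2)
       + 6 * ((real l + 1) * (real l + 2) * (real l + 3) / 6)) * (fact l / (fact k * N))"
      unfolding poch combine[symmetric] by (simp add: d_def)
    finally show ?thesis unfolding e_def newton[symmetric] .
  qed
  then show ?thesis using N0 by (intro exI[of _ d]) (auto simp: N_def)
qed

section \<open>Approximation by Taylor polynomials of dilations\<close>

lemma taylor_coeff_scaled_le_1:
  assumes f: "f holomorphic_on disk" "\<And>z. z \<in> disk \<Longrightarrow> cmod (f z) \<le> 1" and s: "0 < s" "s < 1"
  shows "cmod ((deriv ^^ j) f 0 / fact j) * s ^ j \<le> 1"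
proof -
  have sub: "cball 0 s \<subseteq> disk" using s by auto
  have "cmod ((deriv ^^ j) f 0) \<le> fact j * 1 / s ^ j"
  proof (rule Cauchy_inequality)
    show "f holomorphic_on ball 0 s" "continuous_on (cball 0 s) f"
      by (rule holomorphic_on_subset[OF f(1) order.trans[OF ball_subset_cball sub]])
        (rule holomorphic_on_imp_continuous_on[OF holomorphic_on_subset[OF f(1) sub]])
    show "cmod (f x) \<le> 1" if "cmod (0 - x) = s" for x
      using that s by (intro f(2)) simp
  qed (fact s)
  then show ?thesis using s by (simp add: norm_divide field_simps)
qed

text \<open>Dilating by \<open>s\<^sup>2\<close> supplies \<open>s ^ j\<close> twice: one copy
  absorbs the Cauchy bound of the coefficient, the other leaves a geometric tail that is uniform in
  \<open>f\<close> and \<open>z\<close>.\<close>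

lemma dilated_taylor_remainder:
  assumes f: "f holomorphic_on disk" "\<And>z. z \<in> disk \<Longrightarrow> cmod (f z) \<le> 1" and s: "0 < s" "s < 1"
    and z: "z \<in> disk"
  shows "cmod (f (of_real (s\<^sup>2) * z) - (\<Sum>j<N. (deriv ^^ j) f 0 / fact j * of_real (s\<^sup>2) ^ j * z ^ j)) \<le> s ^ N / (1 - s)"
proof -
  let ?w = "of_real (s\<^sup>2) * z"
  define t where "t j = (deriv ^^ j) f 0 / fact j * of_real (s\<^sup>2) ^ j * z ^ j" for j
  have z1: "cmod z < 1" using z by simp
  have "s\<^sup>2 < 1" using s by (simp add: power_less_one_iff)
  then have "s\<^sup>2 * cmod z < 1 * 1" using z1 s by (intro mult_strict_mono') auto
  then have "?w \<in> disk" by (simp add: norm_mult norm_power)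
  then have "(\<lambda>j. (deriv ^^ j) f 0 / fact j * (?w - 0) ^ j) sums f ?w"
    by (intro holomorphic_power_series[of f 0 1]) (use f in auto)
  then have "t sums f ?w" by (simp add: t_def[abs_def] power_mult_distrib mult.assoc)
  then have "(\<lambda>j. t (j + N)) sums (f ?w - (\<Sum>j<N. t j))" by (simp add: sums_iff_shift)
  then have eq: "f ?w - (\<Sum>j<N. t j) = (\<Sum>j. t (j + N))" by (rule sums_unique)
  have t_le: "cmod (t j) \<le> s ^ j" for j
  proof -
    have "cmod (t j) = (cmod ((deriv ^^ j) f 0 / fact j) * s ^ j) * (s ^ j * cmod z ^ j)"
      using s by (simp add: t_def norm_mult norm_power norm_divide power2_eq_square power_mult_distrib)
    also have "\<dots> \<le> 1 * (s ^ j * 1)"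
      using taylor_coeff_scaled_le_1[OF f s, of j] z1 s
      by (intro mult_mono) (auto intro!: power_le_one)
    finally show ?thesis by simp
  qed
  have sums: "(\<lambda>j. s ^ (j + N)) sums (s ^ N / (1 - s))"
    using sums_mult[OF geometric_sums[of s], of "s ^ N"] s by (simp add: power_add mult.commute)
  have "cmod (\<Sum>j. t (j + N)) \<le> (\<Sum>j. s ^ (j + N))"
    by (rule norm_suminf_le[OF t_le sums_summable[OF sums]])
  then show ?thesis using sums_unique[OF sums] eq unfolding t_def by simp
qed

text \<open>Mean value estimate on the convex set \<open>cball 0 \<rho>\<close>, where the weighted
  Cauchy bound of order 1 gives the Lipschitz constant
  \<open>4 / (1 - \<rho>\<^sup>2)\<close>.\<close>

lemma dilation_error:
  assumes f: "f holomorphic_on disk" "\<And>z. z \<in> disk \<Longrightarrow> cmod (f z) \<le> 1"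
    and r: "0 \<le> r" "r \<le> 1" and w: "cmod w \<le> \<rho>" "\<rho> < 1"
  shows "cmod (f w - f (of_real r * w)) \<le> 4 / (1 - \<rho>\<^sup>2) * (1 - r)"
proof -
  have \<rho>0: "\<rho> \<ge> 0" using w(1) norm_ge_zero order.trans by blast
  have \<rho>2: "\<rho>\<^sup>2 < 1" using \<rho>0 w(2) by (simp add: power_less_one_iff)
  have "cmod (f w - f (of_real r * w)) \<le> 4 / (1 - \<rho>\<^sup>2) * cmod (w - of_real r * w)"
  proof (rule field_differentiable_bound[of "cball 0 \<rho>" f "deriv f"])
    fix z :: complex assume z: "z \<in> cball 0 \<rho>"
    then have zd: "z \<in> disk" using w(2) by auto
    then show "(f has_field_derivative deriv f z) (at z within cball 0 \<rho>)"
      using f(1) by (intro holomorphic_derivI[of _ disk]) auto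
    have "cmod (deriv f z) * (1 - \<rho>\<^sup>2) \<le> cmod (deriv f z) * (1 - (cmod z)\<^sup>2)"
      using z by (intro mult_left_mono) (auto intro!: power_mono)
    also have "\<dots> \<le> 4" using higher_deriv_weighted_bound[OF f zd, of 1] by simp
    finally show "cmod (deriv f z) \<le> 4 / (1 - \<rho>\<^sup>2)" using \<rho>2 by (simp add: field_simps)
  next
    have "r * cmod w \<le> 1 * \<rho>" using r w \<rho>0 by (intro mult_mono) auto
    then show "w \<in> cball 0 \<rho>" "of_real r * w \<in> cball 0 \<rho>" using r w(1) by (auto simp: norm_mult)
  qed simp
  also have "cmod (w - of_real r * w) = (1 - r) * cmod w"
  proof -
    have "w - of_real r * w = of_real (1 - r) * w" by (simp add: algebra_simps)
    then show ?thesis using r by (simp only: norm_mult norm_of_real)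
  qed
  also have "4 / (1 - \<rho>\<^sup>2) * ((1 - r) * cmod w) \<le> 4 / (1 - \<rho>\<^sup>2) * ((1 - r) * 1)"
    using \<rho>2 r w by (intro mult_left_mono) auto
  finally show ?thesis by simp
qed

text \<open>The dilation and the degree serve all \<open>f\<close> at once, so the polynomial
  depends linearly on \<open>f\<close>. On the disk the bound 3 is 2 for the dilation difference
  plus 1 for the Taylor tail; on the compact disk each of the two errors is at most
  \<open>\<eta> / 2\<close>.\<close>

lemma ex_finite_rank_approximation:
  fixes \<rho> \<eta> :: real
  assumes \<rho>: "0 \<le> \<rho>" "\<rho> < 1" and \<eta>: "\<eta> > 0"
  obtains s :: real and N :: nat where
    "\<And>f j. f holomorphic_on disk \<Longrightarrow> (\<And>z. z \<in> disk \<Longrightarrow> cmod (f z) \<le> 1) \<Longrightarrow>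
       cmod ((deriv ^^ j) f 0 / fact j * of_real s ^ j) \<le> 1"
    "\<And>f z. f holomorphic_on disk \<Longrightarrow> (\<And>z. z \<in> disk \<Longrightarrow> cmod (f z) \<le> 1) \<Longrightarrow> z \<in> disk \<Longrightarrow>
       cmod (f z - (\<Sum>j<N. (deriv ^^ j) f 0 / fact j * of_real s ^ j * z ^ j)) \<le> 3"
    "\<And>f z. f holomorphic_on disk \<Longrightarrow> (\<And>z. z \<in> disk \<Longrightarrow> cmod (f z) \<le> 1) \<Longrightarrow> cmod z \<le> \<rho> \<Longrightarrow>
       cmod (f z - (\<Sum>j<N. (deriv ^^ j) f 0 / fact j * of_real s ^ j * z ^ j)) \<le> \<eta>"
proof -
  have \<rho>2: "\<rho>\<^sup>2 < 1" using \<rho> by (simp add: power_less_one_iff)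
  \<comment> \<open>The dilation factor returned is the square of this \<open>s\<close>. Since
    \<open>1 - s\<^sup>2 \<le> 2 * (1 - s)\<close>, the divisor 16 makes the dilation error at most
    \<open>\<eta> / 2\<close>; the minimum with 1/2 keeps \<open>s\<close> positive.\<close>
  define s where "s = 1 - min (1/2) (\<eta> * (1 - \<rho>\<^sup>2) / 16)"
  have s: "0 < s" "s < 1" and s16: "1 - s \<le> \<eta> * (1 - \<rho>\<^sup>2) / 16"
    using \<rho>2 \<eta> by (auto simp: s_def min_def)
  have s2: "0 \<le> s\<^sup>2" "s\<^sup>2 \<le> 1" using s by (auto simp: power_le_one)
  have "(\<lambda>N. s ^ N / (1 - s)) \<longlonglongrightarrow> 0 / (1 - s)"
    using s by (intro tendsto_intros LIMSEQ_realpow_zero) auto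
  then have "eventually (\<lambda>N. s ^ N / (1 - s) < min 1 (\<eta> / 2)) sequentially"
    using \<eta> by (intro order_tendstoD) auto
  then obtain N where N: "s ^ N / (1 - s) < min 1 (\<eta> / 2)"
    by (auto simp: eventually_sequentially)
  have "1 - s\<^sup>2 = (1 - s) * (1 + s)" by (simp add: power2_eq_square algebra_simps)
  also have "\<dots> \<le> (1 - s) * 2" using s by (intro mult_left_mono) auto
  also have "\<dots> \<le> \<eta> * (1 - \<rho>\<^sup>2) / 8" using s16 by simp
  finally have s8: "4 / (1 - \<rho>\<^sup>2) * (1 - s\<^sup>2) \<le> \<eta> / 2" using \<rho>2 by (simp add: field_simps)
  show thesis
  proof (rule that)
    fix f :: "complex \<Rightarrow> complex" and z :: complex and j
    assume f: "f holomorphic_on disk" "\<And>z. z \<in> disk \<Longrightarrow> cmod (f z) \<le> 1"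
    have "cmod ((deriv ^^ j) f 0 / fact j * of_real (s\<^sup>2) ^ j) = (cmod ((deriv ^^ j) f 0 / fact j) * s ^ j) * s ^ j"
      using s by (simp add: norm_mult norm_power norm_divide power2_eq_square power_mult_distrib)
    also have "\<dots> \<le> 1 * 1"
      using taylor_coeff_scaled_le_1[OF f s, of j] s by (intro mult_mono) (auto intro!: power_le_one)
    finally show "cmod ((deriv ^^ j) f 0 / fact j * of_real (s\<^sup>2) ^ j) \<le> 1" by simp
    let ?p = "\<Sum>j<N. (deriv ^^ j) f 0 / fact j * of_real (s\<^sup>2) ^ j * z ^ j"
    have tri: "cmod (f z - ?p) \<le> cmod (f z - f (of_real (s\<^sup>2) * z)) + cmod (f (of_real (s\<^sup>2) * z) - ?p)"
      by (rule order.trans[OF _ norm_triangle_ineq]) simp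
    {
      assume z: "z \<in> disk"
      have "s\<^sup>2 * cmod z \<le> 1 * cmod z" using s2 by (intro mult_right_mono) auto
      then have "of_real (s\<^sup>2) * z \<in> disk" using z by (simp add: norm_mult norm_power)
      then have "cmod (f z - f (of_real (s\<^sup>2) * z)) \<le> 1 + 1"
        using f z by (intro order.trans[OF norm_triangle_ineq4] add_mono)
      then show "cmod (f z - ?p) \<le> 3"
        using tri dilated_taylor_remainder[OF f s z, of N] N by simp
    }
    {
      assume z: "cmod z \<le> \<rho>"
      then have zd: "z \<in> disk" using \<rho>(2) by simp
      show "cmod (f z - ?p) \<le> \<eta>"
        using tri dilated_taylor_remainder[OF f s zd, of N] N dilation_error[OF f s2 z \<rho>(2)] s8
        unfolding min_less_iff_conj by linarith
    }
  qed
qed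

text \<open>Multiplying by \<open>inverse C\<close> frees the infimum of its factor, so that its
  universal property applies.\<close>

lemma le_ennreal_mult_INF:
  assumes "C > 0" "\<And>x. x \<in> S \<Longrightarrow> Q \<le> ennreal C * g x"
  shows "Q \<le> ennreal C * (INF x\<in>S. g x)"
proof -
  have inv: "ennreal (inverse C) * (ennreal C * y) = y" "ennreal C * (ennreal (inverse C) * y) = y" for y
    using assms(1) by (simp_all add: mult.assoc[symmetric] ennreal_mult[symmetric])
  have "ennreal (inverse C) * Q \<le> (INF x\<in>S. g x)"
  proof (rule INF_greatest)
    fix x assume "x \<in> S"
    then have "ennreal (inverse C) * Q \<le> ennreal (inverse C) * (ennreal C * g x)"
      by (intro mult_left_mono assms(2)) auto
    then show "ennreal (inverse C) * Q \<le> g x" by (simp only: inv)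
  qed
  then have "ennreal C * (ennreal (inverse C) * Q) \<le> ennreal C * (INF x\<in>S. g x)"
    by (rule mult_left_mono) simp
  then show ?thesis by (simp only: inv)
qed

section \<open>Linear structure of the bounded analytic functions\<close>

lemma Hinf_bounded:
  assumes "f \<in> Hinf"
  obtains B where "B \<ge> 0" "\<And>z. z \<in> disk \<Longrightarrow> cmod (f z) \<le> B"
proof (rule that)
  fix z :: complex assume "z \<in> disk"
  then have "ennreal (cmod (f z)) \<le> Hinf_norm f"
    unfolding Hinf_norm_def by (rule SUP_upper)
  also have "\<dots> = ennreal (enn2real (Hinf_norm f))"
    using assms by (simp add: Hinf_def)
  finally show "cmod (f z) \<le> enn2real (Hinf_norm f)"
    by (simp add: ennreal_le_iff)
qed simp

lemma Hinf_I:
  assumes "f holomorphic_on disk" "\<And>z. z \<notin> disk \<Longrightarrow> f z = 0" "\<And>z. z \<in> disk \<Longrightarrow> cmod (f z) \<le> B" "B \<ge> 0"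
  shows "f \<in> Hinf" "Hinf_norm f \<le> ennreal B"
proof -
  have "on_disk f = f" using assms(2) by (auto simp: on_disk_def fun_eq_iff)
  then show "f \<in> Hinf" "Hinf_norm f \<le> ennreal B"
    using on_disk_Hinf[OF assms(1,3,4)] by auto
qed

lemma Hinf_vanishes: "f \<in> Hinf \<Longrightarrow> z \<notin> disk \<Longrightarrow> f z = 0"
  unfolding Hinf_def disk_analytic_def by blast

lemma Hinf_add:
  assumes "f \<in> Hinf" "g \<in> Hinf"
  shows "(\<lambda>z. f z + g z) \<in> Hinf"
proof -
  obtain B where B: "B \<ge> 0" "\<And>z. z \<in> disk \<Longrightarrow> cmod (f z) \<le> B" using Hinf_bounded[OF assms(1)] by blast
  obtain B' where B': "B' \<ge> 0" "\<And>z. z \<in> disk \<Longrightarrow> cmod (g z) \<le> B'" using Hinf_bounded[OF assms(2)] by blast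
  show ?thesis
  proof (rule Hinf_I(1))
    show "cmod (f z + g z) \<le> B + B'" if "z \<in> disk" for z
      using B(2)[OF that] B'(2)[OF that] by (rule norm_triangle_mono)
  qed (use assms B B' in \<open>auto intro!: holomorphic_intros dest: HinfD simp: Hinf_vanishes simp del: mem_ball_0\<close>)
qed

lemma Hinf_cmult:
  assumes "f \<in> Hinf"
  shows "(\<lambda>z. c * f z) \<in> Hinf"
proof -
  obtain B where B: "B \<ge> 0" "\<And>z. z \<in> disk \<Longrightarrow> cmod (f z) \<le> B" using Hinf_bounded[OF assms] by blast
  show ?thesis
  proof (rule Hinf_I(1))
    show "cmod (c * f z) \<le> cmod c * B" if "z \<in> disk" for z
      using B(2)[OF that] by (simp add: norm_mult mult_left_mono)
  qed (use assms B in \<open>auto intro!: holomorphic_intros dest: HinfD simp: Hinf_vanishes simp del: mem_ball_0\<close>)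
qed

lemma Hinf_sum: "(\<And>j. j < N \<Longrightarrow> g j \<in> Hinf) \<Longrightarrow> (\<lambda>z. \<Sum>j<N. c j * g j z) \<in> Hinf" for N :: nat
proof (induction N)
  case 0
  show ?case by (rule Hinf_I(1)[of _ 0]) auto
next
  case (Suc N)
  then show ?case using Hinf_add[of "\<lambda>z. \<Sum>j<N. c j * g j z" "\<lambda>z. c N * g N z"] by (simp add: Hinf_cmult)
qed

lemma linear_operatorD:
  assumes "linear_operator X Y T" "f \<in> X"
  shows "T f \<in> Y" "g \<in> X \<Longrightarrow> T (\<lambda>z. f z + g z) = (\<lambda>z. T f z + T g z)"
    "T (\<lambda>z. c * f z) = (\<lambda>z. c * T f z)"
  using assms by (simp_all add: linear_operator_def)

lemma linear_operator_sum:
  fixes N :: nat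
  assumes T: "linear_operator Hinf Y T" and g: "\<And>j. j < N \<Longrightarrow> g j \<in> Hinf"
  shows "T (\<lambda>z. \<Sum>j<N. c j * g j z) = (\<lambda>z. \<Sum>j<N. c j * T (g j) z)"
  using g
proof (induction N)
  case 0
  have "(\<lambda>_. 0) \<in> Hinf" using Hinf_sum[of 0 "\<lambda>_ _. 0"] by simp
  from linear_operatorD(3)[OF T this, of 0] show ?case by simp
next
  case (Suc N)
  have "(\<lambda>z. \<Sum>j<N. c j * g j z) \<in> Hinf" "(\<lambda>z. c N * g N z) \<in> Hinf" "g N \<in> Hinf"
    using Suc.prems by (auto intro: Hinf_sum Hinf_cmult)
  then show ?case using T Suc unfolding linear_operator_def by simp
qed

lemma linear_operator_cmult_diff:
  assumes T: "linear_operator Hinf Y T" and "f \<in> Hinf" "g \<in> Hinf"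
  shows "T (\<lambda>z. c * (f z - g z)) = (\<lambda>z. c * (T f z - T g z))"
proof -
  have g: "(\<lambda>z. (-1) * g z) \<in> Hinf" using assms(3) by (rule Hinf_cmult)
  have fg: "(\<lambda>z. f z + (-1) * g z) \<in> Hinf" using assms(2) g by (rule Hinf_add)
  have "T (\<lambda>z. c * (f z + (-1) * g z)) = (\<lambda>z. c * T (\<lambda>z. f z + (-1) * g z) z)"
    by (rule linear_operatorD(3)[OF T fg])
  also have "T (\<lambda>z. f z + (-1) * g z) = (\<lambda>z. T f z + T (\<lambda>z. (-1) * g z) z)"
    by (rule linear_operatorD(2)[OF T assms(2) g])
  also have "T (\<lambda>z. (-1) * g z) = (\<lambda>z. (-1) * T g z)"
    by (rule linear_operatorD(3)[OF T assms(3)])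
  finally show ?thesis by simp
qed

text \<open>The sup bound \<open>2 * real M ^ k\<close> of the jet function, taken at
  \<open>M = n + 2\<close> and at the largest order \<open>k = n + 1\<close>. Like
  \<open>growth_bound\<close>, it is defined outside the locale, so its independence of the symbols
  is visible.\<close>

definition peak_bound :: "nat \<Rightarrow> real" where
  "peak_bound n = 2 * real (n + 2) ^ (n + 1)"

text \<open>The sum collects the Cauchy constants of the four orders. The 2 leaves room for the
  value at 0 and for the points that \<open>\<phi>\<close> keeps away from the boundary.\<close>

definition growth_bound :: "nat \<Rightarrow> nat \<Rightarrow> real" where
  "growth_bound m n = 2 + (\<Sum>k\<in>{m, m + 1, n, n + 1}. fact k * 4 ^ k)"

lemma peak_bound_pos: "peak_bound n > 0"
  by (simp add: peak_bound_def)

lemma growth_bound_pos: "growth_bound m n > 0"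
  unfolding growth_bound_def by (intro add_pos_nonneg sum_nonneg) auto

section \<open>The operator\<close>

locale bounded_T = bloch_weight \<mu> for \<mu> +
  fixes m n :: nat and \<psi>1 \<psi>2 \<phi> :: "complex \<Rightarrow> complex"
  assumes mn: "m + 1 < n"
    and hol: "\<psi>1 holomorphic_on disk" "\<psi>2 holomorphic_on disk" "\<phi> holomorphic_on disk"
    and self_map: "\<phi> ` disk \<subseteq> disk"
    and bounded: "bounded_operator Hinf Hinf_norm (Bloch \<mu>) (Bloch_norm \<mu>) (T_op m n \<psi>1 \<psi>2 \<phi>)"
begin

abbreviation "T \<equiv> T_op m n \<psi>1 \<psi>2 \<phi>"
abbreviation "E \<equiv> E_fun m n \<psi>1 \<psi>2 \<phi>"
abbreviation "orders \<equiv> {m, m + 1, n, n + 1}"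
abbreviation "K \<equiv> peak_bound n"
abbreviation "C1 \<equiv> growth_bound m n"

definition A :: "nat \<Rightarrow> complex \<Rightarrow> real" where
  "A k z = \<mu> z * cmod (E k z) / (1 - (cmod (\<phi> z))\<^sup>2) ^ k"

definition boundary_size :: ennreal where
  "boundary_size = Max ((\<lambda>k. limsup_to_bdry \<phi> (\<lambda>z. ennreal (A k z))) ` orders)"

definition test_size :: ennreal where
  "test_size = Max ((\<lambda>i. limsup_to_bdry \<phi> (\<lambda>w. Bloch_norm \<mu> (T (f_test i (\<phi> w))))) ` {1..4})"

lemma phi_disk: "z \<in> disk \<Longrightarrow> \<phi> z \<in> disk"
  using self_map by blast

lemma one_minus_phi_sq:
  assumes "z \<in> disk"
  shows "0 < 1 - (cmod (\<phi> z))\<^sup>2" "1 - (cmod (\<phi> z))\<^sup>2 \<le> 1"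
  using phi_disk[OF assms] by (auto simp: power_less_one_iff)

lemma A_nonneg: "z \<in> disk \<Longrightarrow> A k z \<ge> 0"
  unfolding A_def using weight_pos[of z] one_minus_phi_sq[of z] by simp

lemma linear_T: "linear_operator Hinf (Bloch \<mu>) T"
  using bounded by (simp add: bounded_operator_def)

lemma T_in_Bloch: "f \<in> Hinf \<Longrightarrow> T f \<in> Bloch \<mu>"
  using linear_T by (simp add: linear_operator_def)

lemma sum_orders: "(\<Sum>k\<in>orders. g k) = g m + g (m + 1) + g n + g (n + 1)"
  for g :: "nat \<Rightarrow> 'a :: comm_monoid_add"
  using mn by (simp add: add_ac)

section \<open>The derivative of an image and the size of its coefficients\<close>

text \<open>Product and chain rule. Since \<open>m + 1 < n\<close>, the four orders are distinct and
  the case distinction in \<open>E_fun\<close> picks the right coefficient for each.\<close>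

lemma deriv_T:
  assumes f: "f holomorphic_on disk" and z: "z \<in> disk"
  shows "deriv (T f) z = (\<Sum>k\<in>orders. E k z * (deriv ^^ k) f (\<phi> z))"
proof -
  have d: "(g has_field_derivative deriv g z) (at z)" if "g holomorphic_on disk" for g
    using that z by (intro holomorphic_derivI[of _ disk]) auto
  have df: "((\<lambda>z. (deriv ^^ k) f (\<phi> z)) has_field_derivative (deriv ^^ Suc k) f (\<phi> z) * deriv \<phi> z) (at z)" for k
    by (rule DERIV_chain2[OF has_field_derivative_higher_deriv[OF f open_ball phi_disk[OF z]] d[OF hol(3)]])
  have "((\<lambda>z. \<psi>1 z * (deriv ^^ m) f (\<phi> z) + \<psi>2 z * (deriv ^^ n) f (\<phi> z)) has_field_derivative
      (deriv \<psi>1 z * (deriv ^^ m) f (\<phi> z) + (deriv ^^ Suc m) f (\<phi> z) * deriv \<phi> z * \<psi>1 z) +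
      (deriv \<psi>2 z * (deriv ^^ n) f (\<phi> z) + (deriv ^^ Suc n) f (\<phi> z) * deriv \<phi> z * \<psi>2 z)) (at z)"
    by (intro DERIV_add DERIV_mult d hol df)
  moreover have "eventually (\<lambda>w. T f w = \<psi>1 w * (deriv ^^ m) f (\<phi> w) + \<psi>2 w * (deriv ^^ n) f (\<phi> w)) (nhds z)"
    using eventually_nhds_in_open[OF open_ball z]
    by eventually_elim (simp add: T_op_def on_disk_def)
  ultimately have "(T f has_field_derivative
      (deriv \<psi>1 z * (deriv ^^ m) f (\<phi> z) + (deriv ^^ Suc m) f (\<phi> z) * deriv \<phi> z * \<psi>1 z) +
      (deriv \<psi>2 z * (deriv ^^ n) f (\<phi> z) + (deriv ^^ Suc n) f (\<phi> z) * deriv \<phi> z * \<psi>2 z)) (at z)"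
    by (subst DERIV_cong_ev[OF refl _ refl])
  then show ?thesis
    unfolding sum_orders using mn by (simp add: DERIV_imp_deriv E_fun_def mult_ac)
qed

lemma weighted_deriv_T_le:
  assumes f: "f holomorphic_on disk" and z: "z \<in> disk"
  shows "\<mu> z * cmod (deriv (T f) z)
    \<le> (\<Sum>k\<in>orders. A k z * ((1 - (cmod (\<phi> z))\<^sup>2) ^ k * cmod ((deriv ^^ k) f (\<phi> z))))"
proof -
  have "\<mu> z * cmod (deriv (T f) z) \<le> \<mu> z * (\<Sum>k\<in>orders. cmod (E k z) * cmod ((deriv ^^ k) f (\<phi> z)))"
    unfolding deriv_T[OF f z] using weight_pos[OF z]
    by (intro mult_left_mono sum_norm_le) (auto simp: norm_mult)
  also have "\<dots> = (\<Sum>k\<in>orders. A k z * ((1 - (cmod (\<phi> z))\<^sup>2) ^ k * cmod ((deriv ^^ k) f (\<phi> z))))"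
    unfolding sum_distrib_left A_def using one_minus_phi_sq[OF z]
    by (intro sum.cong refl) simp
  finally show ?thesis .
qed

lemma T_bound:
  obtains B where "B \<ge> 0" "\<And>f. f \<in> Hinf \<Longrightarrow> Hinf_norm f \<le> 1 \<Longrightarrow> Bloch_norm \<mu> (T f) \<le> ennreal B"
proof (rule that)
  let ?N = "op_norm Hinf Hinf_norm (Bloch_norm \<mu>) T"
  fix f assume "f \<in> Hinf" "Hinf_norm f \<le> 1"
  then have "Bloch_norm \<mu> (T f) \<le> ?N"
    unfolding op_norm_def by (intro SUP_upper) simp
  also have "?N = ennreal (enn2real ?N)"
    using bounded by (simp add: bounded_operator_def)
  finally show "Bloch_norm \<mu> (T f) \<le> ennreal (enn2real ?N)" .
qed simp

text \<open>The factor vanishing at \<open>\<zeta>\<close> matters only for \<open>m = 0\<close>: for positive orders the weight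
  \<open>(1 - |w|\<^sup>2)\<^sup>i\<close> alone makes the limit zero.\<close>

lemma ex_peak_function:
  assumes z: "z \<in> disk" and \<zeta>: "cmod \<zeta> = 1" and k: "k \<in> orders"
  obtains H where "H \<in> Hinf" "\<And>w. w \<in> disk \<Longrightarrow> cmod (H w) \<le> 1" 
    "A k z \<le> K * (\<mu> z * cmod (deriv (T H) z))"
    "\<And>i. ((\<lambda>w. (1 - (cmod w)\<^sup>2) ^ i * cmod ((deriv ^^ i) H w)) \<longlongrightarrow> 0) (at \<zeta> within disk)"
proof -
  define a where "a = \<phi> z"
  have a: "cmod a < 1" using phi_disk[OF z] by (simp add: a_def)
  define S where "S = {z. 1 - cnj a * z \<noteq> 0}"
  obtain h where h: "h holomorphic_on S" "h \<zeta> = 0" "\<And>z. cmod z < 1 \<Longrightarrow> cmod (h z) \<le> 2 * real (n + 2) ^ k"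
    "\<And>i. i < n + 2 \<Longrightarrow> (deriv ^^ i) h a = (if i = k then fact k / of_real (1 - (cmod a)\<^sup>2) ^ k else 0)"
    \<comment> \<open>The derivative of an image involves orders up to \<open>n + 1\<close>, so the
      jet must be prescribed below \<open>n + 2\<close>.\<close>
    using ex_jet_function[OF a \<zeta>, of "n + 2" k] unfolding S_def by auto
  have openS: "open S" unfolding S_def by (intro open_Collect_neq continuous_intros)
  have diskS: "disk \<subseteq> S" and \<zeta>S: "\<zeta> \<in> S"
    using one_minus_cnj_mult_neq_0[OF a] \<zeta> by (auto simp: S_def)
  have hd: "h holomorphic_on disk" using h(1) diskS by (rule holomorphic_on_subset)
  let ?g = "\<lambda>w. 1 / of_real K * h w"
  have gd: "?g holomorphic_on disk" using hd peak_bound_pos[of n] by (intro holomorphic_intros) auto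
  define H where "H = on_disk ?g"
  have kn: "k \<le> n + 1" using k mn by auto
  have "cmod (?g w) \<le> 1" if "w \<in> disk" for w
  proof -
    have "cmod (h w) \<le> 2 * real (n + 2) ^ k" using h(3) that by simp
    also have "\<dots> \<le> K" unfolding peak_bound_def using kn by (intro mult_left_mono power_increasing) auto
    finally show ?thesis using peak_bound_pos[of n] by (simp add: norm_mult norm_divide divide_le_eq_1)
  qed
  note g_le = this
  have H: "H \<in> Hinf" using on_disk_Hinf(1)[OF gd g_le] by (simp add: H_def)
  have H_le: "cmod (H w) \<le> 1" if "w \<in> disk" for w using g_le[OF that] that by (simp add: H_def on_disk_def)
  have dH: "(deriv ^^ i) H w = 1 / of_real K * (deriv ^^ i) h w" if "w \<in> disk" for i w
    unfolding H_def higher_deriv_on_disk[OF gd that] by (rule higher_deriv_cmult[OF hd that open_ball])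
  have "deriv (T H) z = (\<Sum>i\<in>orders. E i z * (deriv ^^ i) H a)"
    unfolding a_def by (rule deriv_T[OF HinfD(1)[OF H] z])
  also have "\<dots> = (\<Sum>i\<in>orders. if i = k then E k z * (1 / of_real K * (fact k / of_real (1 - (cmod a)\<^sup>2) ^ k)) else 0)"
  proof (intro sum.cong refl)
    fix i assume "i \<in> orders"
    then have "i < n + 2" using mn by auto
    moreover have "a \<in> disk" using a by simp
    ultimately show "E i z * (deriv ^^ i) H a
      = (if i = k then E k z * (1 / of_real K * (fact k / of_real (1 - (cmod a)\<^sup>2) ^ k)) else 0)"
      by (simp add: dH h(4) del: of_real_diff)
  qed
  also have "\<dots> = E k z * (1 / of_real K * (fact k / of_real (1 - (cmod a)\<^sup>2) ^ k))"
    using k by (subst sum.delta) (auto simp del: of_real_diff)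
  finally have "\<mu> z * cmod (deriv (T H) z) = \<mu> z * cmod (E k z * (1 / of_real K * (fact k / of_real (1 - (cmod a)\<^sup>2) ^ k)))"
    by simp
  also have "\<dots> = A k z * fact k / K"
    using peak_bound_pos[of n] one_minus_phi_sq[OF z] unfolding A_def a_def
    by (simp add: norm_mult norm_divide norm_power mult_ac del: of_real_diff)
  finally have "K * (\<mu> z * cmod (deriv (T H) z)) = A k z * fact k" using peak_bound_pos[of n] by simp
  moreover have "A k z * 1 \<le> A k z * fact k"
    using A_nonneg[OF z] by (intro mult_left_mono) auto
  ultimately have peak: "A k z \<le> K * (\<mu> z * cmod (deriv (T H) z))" by simp
  have lim: "((\<lambda>w. (1 - (cmod w)\<^sup>2) ^ i * cmod ((deriv ^^ i) H w)) \<longlongrightarrow> 0) (at \<zeta> within disk)" for i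
  proof -
    \<comment> \<open>The function \<open>h\<close> is holomorphic across \<open>\<zeta>\<close>,
      since its domain \<open>S\<close> is open and contains \<open>\<zeta>\<close>; hence its
      derivatives stay bounded there and the weight or the zero of \<open>h\<close> decides the
      limit.\<close>
    have "continuous_on S ((deriv ^^ i) h)"
      using h(1) openS by (intro holomorphic_on_imp_continuous_on holomorphic_higher_deriv)
    then have "isCont ((deriv ^^ i) h) \<zeta>" using openS \<zeta>S by (simp add: continuous_on_eq_continuous_at)
    then have "isCont (\<lambda>w. (1 - (cmod w)\<^sup>2) ^ i * cmod (1 / of_real K * (deriv ^^ i) h w)) \<zeta>"
      by (intro continuous_intros)
    moreover have "(1 - (cmod \<zeta>)\<^sup>2) ^ i * cmod (1 / of_real K * (deriv ^^ i) h \<zeta>) = 0"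
      using \<zeta> h(2) by (cases i) auto
    ultimately have "((\<lambda>w. (1 - (cmod w)\<^sup>2) ^ i * cmod (1 / of_real K * (deriv ^^ i) h w)) \<longlongrightarrow> 0) (at \<zeta>)"
      by (simp only: isCont_def)
    then have "((\<lambda>w. (1 - (cmod w)\<^sup>2) ^ i * cmod (1 / of_real K * (deriv ^^ i) h w)) \<longlongrightarrow> 0) (at \<zeta> within disk)"
      by (rule tendsto_within_subset) simp
    then show ?thesis
      by (rule Lim_transform_eventually) (auto simp: eventually_at_filter dH simp del: mem_ball_0 intro!: always_eventually)
  qed
  show thesis using that[OF H H_le peak lim] .
qed

text \<open>Boundedness of the operator, tested at each \<open>z\<close> on a peak function adapted
  to that point. The boundary point \<open>\<zeta>\<close> can be arbitrary here and is taken to be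
  1.\<close>

lemma A_bounded:
  obtains B where "B \<ge> 0" "\<And>k z. k \<in> orders \<Longrightarrow> z \<in> disk \<Longrightarrow> A k z \<le> B"
proof -
  obtain B where B: "B \<ge> 0" "\<And>f. f \<in> Hinf \<Longrightarrow> Hinf_norm f \<le> 1 \<Longrightarrow> Bloch_norm \<mu> (T f) \<le> ennreal B"
    using T_bound by blast
  show thesis
  proof (rule that)
    fix k z assume kz: "k \<in> orders" "z \<in> disk"
    obtain H where H: "H \<in> Hinf" "\<And>w. w \<in> disk \<Longrightarrow> cmod (H w) \<le> 1" 
      "A k z \<le> K * (\<mu> z * cmod (deriv (T H) z))"
      using ex_peak_function[OF kz(2) norm_one kz(1)] by metis
    have "Hinf_norm H \<le> 1"
      unfolding Hinf_norm_def by (intro SUP_least) (simp add: H(2) del: mem_ball_0)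
    then have "\<mu> z * cmod (deriv (T H) z) \<le> B"
      using B H(1) kz(2) by (intro Bloch_norm_leD(2))
    then have "K * (\<mu> z * cmod (deriv (T H) z)) \<le> K * B"
      using peak_bound_pos[of n] by simp
    then show "A k z \<le> K * B" using H(3) by simp
  qed (use B peak_bound_pos[of n] in simp)
qed

section \<open>Upper estimates by the boundary size\<close>

text \<open>Split according to \<open>cmod (\<phi> z)\<close>. Near the boundary the coefficients
  are at most \<open>c\<close> and the weighted derivatives obey Cauchy's bound; elsewhere the
  coefficients are merely bounded but the derivatives of \<open>f\<close> are small. The thresholds
  do not depend on \<open>f\<close>.\<close>

lemma Bloch_norm_T_le_if_small_inside:
  assumes c: "c > 0" and \<delta>: "\<delta> < 1"
    and A_le: "\<And>k z. k \<in> orders \<Longrightarrow> z \<in> disk \<Longrightarrow> cmod (\<phi> z) > \<delta> \<Longrightarrow> A k z \<le> c"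
  obtains \<eta> \<rho> where "\<eta> > 0" "0 \<le> \<rho>" "\<rho> < 1"
    "\<And>f. f holomorphic_on disk \<Longrightarrow> (\<And>z. z \<in> disk \<Longrightarrow> cmod (f z) \<le> 1) \<Longrightarrow>
       (\<And>z. cmod z \<le> \<rho> \<Longrightarrow> cmod (f z) \<le> \<eta>) \<Longrightarrow> Bloch_norm \<mu> (T f) \<le> ennreal (C1 * c)"
proof -
  obtain B where B: "B \<ge> 0" "\<And>k z. k \<in> orders \<Longrightarrow> z \<in> disk \<Longrightarrow> A k z \<le> B"
    using A_bounded by blast
  \<comment> \<open>Including \<open>\<phi> 0\<close> in the inner disk also controls the summand
    \<open>T f 0\<close> of the Bloch norm.\<close>
  define \<delta>' where "\<delta>' = max \<delta> (cmod (\<phi> 0))"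
  have \<delta>': "\<delta> \<le> \<delta>'" "cmod (\<phi> 0) \<le> \<delta>'" "0 \<le> \<delta>'" "\<delta>' < 1"
    using \<delta> phi_disk[of 0] by (auto simp: \<delta>'_def intro: max.coboundedI2)
  define \<rho> where "\<rho> = (1 + \<delta>') / 2"
  have \<rho>: "0 \<le> \<rho>" "\<delta>' < \<rho>" "\<rho> < 1" using \<delta>' by (auto simp: \<rho>_def)
  define D where "D = (\<Sum>k\<in>orders. fact k / (\<rho> - \<delta>') ^ k)"
  have D_ge: "fact k / (\<rho> - \<delta>') ^ k \<le> D" if "k \<in> orders" for k
    unfolding D_def using that \<rho> by (intro member_le_sum) auto
  have D0: "D \<ge> 0" unfolding D_def using \<rho> by (intro sum_nonneg) auto
  define P where "P = cmod (\<psi>1 0) + cmod (\<psi>2 0)"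
  have P0: "P \<ge> 0" by (simp add: P_def)
  \<comment> \<open>This makes both \<open>P * D * \<eta>\<close>, the bound at the origin, and
    \<open>B * D * \<eta>\<close>, the bound over the inner part, at most \<open>c\<close>.\<close>
  define \<eta> where "\<eta> = c / (1 + P * D + B * D)"
  have den: "1 + P * D + B * D > 0" using P0 D0 B(1) by (intro add_pos_nonneg) auto
  have \<eta>: "\<eta> > 0" using c den by (simp add: \<eta>_def)
  have "(P * D + B * D) * \<eta> \<le> (1 + P * D + B * D) * \<eta>" using \<eta> by (intro mult_right_mono) auto
  also have "\<dots> = c" using den by (simp add: \<eta>_def)
  finally have sum_le: "P * D * \<eta> + B * D * \<eta> \<le> c" by (simp add: algebra_simps)
  then have P\<eta>: "P * (D * \<eta>) \<le> c" and B\<eta>: "B * (D * \<eta>) \<le> c"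
    using P0 D0 B(1) \<eta> by (smt (verit) mult.assoc mult_nonneg_nonneg)+
  show thesis
  proof (rule that[OF \<eta> \<rho>(1,3)])
    fix f assume f: "f holomorphic_on disk" "\<And>z. z \<in> disk \<Longrightarrow> cmod (f z) \<le> 1"
      and small: "\<And>z. cmod z \<le> \<rho> \<Longrightarrow> cmod (f z) \<le> \<eta>"
    have inside: "cmod ((deriv ^^ k) f w) \<le> fact k / (\<rho> - \<delta>') ^ k * \<eta>" if "cmod w \<le> \<delta>'" for k w
      using higher_deriv_bound_inside[OF f(1) small \<rho>(2,3) that] by simp
    have inside': "cmod ((deriv ^^ k) f w) \<le> D * \<eta>" if "cmod w \<le> \<delta>'" "k \<in> orders" for k w
      using D_ge[OF that(2)] \<eta> by (intro order.trans[OF inside[OF that(1)]] mult_right_mono) auto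
    have "cmod (T f 0) \<le> cmod (\<psi>1 0) * (D * \<eta>) + cmod (\<psi>2 0) * (D * \<eta>)"
    proof -
      have "T f 0 = \<psi>1 0 * (deriv ^^ m) f (\<phi> 0) + \<psi>2 0 * (deriv ^^ n) f (\<phi> 0)"
        by (simp add: T_op_def on_disk_def)
      moreover have "cmod (\<psi>1 0 * (deriv ^^ m) f (\<phi> 0)) \<le> cmod (\<psi>1 0) * (D * \<eta>)"
        unfolding norm_mult by (intro mult_left_mono inside'[OF \<delta>'(2)]) auto
      moreover have "cmod (\<psi>2 0 * (deriv ^^ n) f (\<phi> 0)) \<le> cmod (\<psi>2 0) * (D * \<eta>)"
        unfolding norm_mult by (intro mult_left_mono inside'[OF \<delta>'(2)]) auto
      ultimately show ?thesis by (simp add: norm_triangle_mono)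
    qed
    also have "\<dots> \<le> c" using P\<eta> by (simp add: P_def algebra_simps)
    finally have at0: "cmod (T f 0) \<le> c" .
    have "\<mu> z * cmod (deriv (T f) z) \<le> c + c * (\<Sum>k\<in>orders. fact k * 4 ^ k)" if z: "z \<in> disk" for z
    proof (cases "cmod (\<phi> z) \<le> \<delta>'")
      case True
      have "(\<Sum>k\<in>orders. A k z * ((1 - (cmod (\<phi> z))\<^sup>2) ^ k * cmod ((deriv ^^ k) f (\<phi> z))))
          \<le> (\<Sum>k\<in>orders. B * (1 * (fact k / (\<rho> - \<delta>') ^ k * \<eta>)))"
        using one_minus_phi_sq[OF z] B(1) \<eta> \<rho>
        by (intro sum_mono mult_mono B(2) z inside True power_le_one) (auto intro: less_imp_le)
      also have "\<dots> = B * (D * \<eta>)" by (simp only: D_def sum_distrib_left sum_distrib_right mult_1)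
      also have "\<dots> \<le> c" by (rule B\<eta>)
      also have "c \<le> c + c * (\<Sum>k\<in>orders. fact k * 4 ^ k)"
        using c by (simp add: sum_nonneg)
      finally show ?thesis using weighted_deriv_T_le[OF f(1) z] by simp
    next
      case False
      then have *: "cmod (\<phi> z) > \<delta>" using \<delta>' by simp
      have "(\<Sum>k\<in>orders. A k z * ((1 - (cmod (\<phi> z))\<^sup>2) ^ k * cmod ((deriv ^^ k) f (\<phi> z))))
          \<le> (\<Sum>k\<in>orders. c * (fact k * 4 ^ k))"
      proof (rule sum_mono)
        fix k assume k: "k \<in> orders"
        show "A k z * ((1 - (cmod (\<phi> z))\<^sup>2) ^ k * cmod ((deriv ^^ k) f (\<phi> z))) \<le> c * (fact k * 4 ^ k)"
        proof (rule mult_mono[OF A_le[OF k z *]])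
          show "(1 - (cmod (\<phi> z))\<^sup>2) ^ k * cmod ((deriv ^^ k) f (\<phi> z)) \<le> fact k * 4 ^ k"
            using higher_deriv_weighted_bound[OF f phi_disk[OF z], of k] by (simp add: mult.commute)
        qed (use c one_minus_phi_sq[OF z] in auto)
      qed
      also have "\<dots> \<le> c + c * (\<Sum>k\<in>orders. fact k * 4 ^ k)"
        using c by (simp only: sum_distrib_left[symmetric])
      finally show ?thesis using weighted_deriv_T_le[OF f(1) z] by simp
    qed
    then have "Bloch_norm \<mu> (T f) \<le> ennreal (c + (c + c * (\<Sum>k\<in>orders. fact k * 4 ^ k)))"
      using c by (intro Bloch_norm_le at0) (auto intro!: add_nonneg_nonneg mult_nonneg_nonneg sum_nonneg)
    also have "c + (c + c * (\<Sum>k\<in>orders. fact k * 4 ^ k)) = C1 * c"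
      unfolding growth_bound_def by (simp only: distrib_right mult_2 mult.commute[of c] add.assoc)
    finally show "Bloch_norm \<mu> (T f) \<le> ennreal (C1 * c)" .
  qed
qed

lemma boundary_size_less:
  assumes "boundary_size < ennreal c"
  obtains \<delta> where "\<delta> < 1" "\<And>k z. k \<in> orders \<Longrightarrow> z \<in> disk \<Longrightarrow> cmod (\<phi> z) > \<delta> \<Longrightarrow> A k z \<le> c"
proof -
  \<comment> \<open>For \<open>c \<le> 0\<close> the value \<open>ennreal c\<close> is 0, and
    nothing lies strictly below it.\<close>
  have c: "c > 0" using assms by (cases "c > 0") (auto simp: ennreal_neg not_less)
  have "\<exists>\<delta><1. \<forall>z\<in>disk. cmod (\<phi> z) > \<delta> \<longrightarrow> A k z \<le> c" if k: "k \<in> orders" for k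
  proof -
    have "limsup_to_bdry \<phi> (\<lambda>z. ennreal (A k z)) \<le> boundary_size"
      unfolding boundary_size_def by (rule Max_ge[OF _ imageI[OF k]]) simp
    then have "limsup_to_bdry \<phi> (\<lambda>z. ennreal (A k z)) < ennreal c"
      using assms by (rule le_less_trans)
    then obtain \<delta> where "\<delta> < 1" "\<And>z. z \<in> disk \<Longrightarrow> cmod (\<phi> z) > \<delta> \<Longrightarrow> ennreal (A k z) \<le> ennreal c"
      by (rule limsup_to_bdry_lessD) blast
    then show ?thesis using c by (auto simp: ennreal_le_iff)
  qed
  then obtain \<delta> where \<delta>: "\<And>k. k \<in> orders \<Longrightarrow> \<delta> k < 1"
    "\<And>k z. k \<in> orders \<Longrightarrow> z \<in> disk \<Longrightarrow> cmod (\<phi> z) > \<delta> k \<Longrightarrow> A k z \<le> c"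
    by metis
  show thesis
  proof (rule that)
    show "Max (\<delta> ` orders) < 1" using \<delta>(1) by (subst Max_less_iff) auto
    fix k z assume k: "k \<in> orders" "z \<in> disk" and "cmod (\<phi> z) > Max (\<delta> ` orders)"
    then have "\<delta> k < cmod (\<phi> z)"
      using Max_ge[of "\<delta> ` orders" "\<delta> k"] by (meson finite.intros finite_imageI imageI le_less_trans)
    then show "A k z \<le> c" by (rule \<delta>(2)[OF k])
  qed
qed

text \<open>The test functions are bounded by 1 and, as \<open>cmod (\<phi> w)\<close> tends to 1,
  uniformly small on any compact subdisk, so the preceding estimate applies to them.\<close>

lemma test_size_le: "test_size \<le> ennreal C1 * boundary_size"
proof -
  have "limsup_to_bdry \<phi> (\<lambda>w. Bloch_norm \<mu> (T (f_test i (\<phi> w)))) \<le> ennreal C1 * boundary_size"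
    if i: "i \<in> {1..4}" for i
  proof (rule le_ennreal_mult_if_above[OF growth_bound_pos[of m n]])
    fix c :: real assume c: "c > 0" "boundary_size < ennreal c"
    obtain \<delta> where \<delta>: "\<delta> < 1" "\<And>k z. k \<in> orders \<Longrightarrow> z \<in> disk \<Longrightarrow> cmod (\<phi> z) > \<delta> \<Longrightarrow> A k z \<le> c"
      using boundary_size_less[OF c(2)] by blast
    obtain \<eta> \<rho> where \<eta>: "\<eta> > 0" and \<rho>: "0 \<le> \<rho>" "\<rho> < 1"
      and small: "\<And>f. f holomorphic_on disk \<Longrightarrow> (\<And>z. z \<in> disk \<Longrightarrow> cmod (f z) \<le> 1) \<Longrightarrow>
        (\<And>z. cmod z \<le> \<rho> \<Longrightarrow> cmod (f z) \<le> \<eta>) \<Longrightarrow> Bloch_norm \<mu> (T f) \<le> ennreal (C1 * c)"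
      using Bloch_norm_T_le_if_small_inside[OF c(1) \<delta>] by blast
    show "limsup_to_bdry \<phi> (\<lambda>w. Bloch_norm \<mu> (T (f_test i (\<phi> w)))) \<le> ennreal (C1 * c)"
    proof (rule limsup_to_bdry_le)
      \<comment> \<open>Beyond this threshold the quotient
        \<open>(1 - cmod (\<phi> w)) / (1 - \<rho>)\<close> is at most \<open>min 1 \<eta>\<close>.
        The bound by 1 lets its power \<open>i \<ge> 1\<close> be replaced by the quotient
        itself.\<close>
      show "1 - (1 - \<rho>) * min 1 \<eta> < 1" using \<eta> \<rho> by simp
      fix w assume w: "w \<in> disk" and "1 - (1 - \<rho>) * min 1 \<eta> < cmod (\<phi> w)"
      then have "1 - cmod (\<phi> w) \<le> min 1 \<eta> * (1 - \<rho>)" by (simp add: mult.commute)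
      moreover have "0 < 1 - \<rho>" using \<rho> by simp
      ultimately have x: "(1 - cmod (\<phi> w)) / (1 - \<rho>) \<le> min 1 \<eta>" by (simp only: pos_divide_le_eq)
      have a: "cmod (\<phi> w) < 1" using phi_disk[OF w] by simp
      show "Bloch_norm \<mu> (T (f_test i (\<phi> w))) \<le> ennreal (C1 * c)"
      proof (rule small)
        show "f_test i (\<phi> w) holomorphic_on disk" by (rule HinfD(1)[OF f_test_Hinf(1)[OF a]])
        show "cmod (f_test i (\<phi> w) z) \<le> 1" if "z \<in> disk" for z
          by (rule Hinf_norm_le_1D[OF f_test_Hinf(2)[OF a] that])
        fix z assume z: "cmod z \<le> \<rho>"
        then have "z \<in> disk" using \<rho> by simp
        then have "cmod (f_test i (\<phi> w) z) \<le> ((1 - cmod (\<phi> w)) / (1 - cmod z)) ^ i"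
          by (rule f_test_Hinf(3)[OF a])
        also have "\<dots> \<le> ((1 - cmod (\<phi> w)) / (1 - \<rho>)) ^ i"
          using a z \<rho> by (intro power_mono frac_le) auto
        also have "\<dots> \<le> ((1 - cmod (\<phi> w)) / (1 - \<rho>)) ^ 1"
          using a x \<rho> i by (intro power_decreasing) auto
        also have "\<dots> \<le> \<eta>" using x by simp
        finally show "cmod (f_test i (\<phi> w) z) \<le> \<eta>" .
      qed
    qed
  qed
  then show ?thesis unfolding test_size_def by (subst Max_le_iff) auto
qed

section \<open>Recovering the coefficients from the test functions\<close>

text \<open>At \<open>a = \<phi> w\<close> the rescaled derivatives of the four images are
  combinations of the same unknowns \<open>X l\<close>, with rising factorials as matrix entries.
  The weights \<open>d\<close> isolate \<open>X k\<close>, and \<open>cmod a > 1 / 2\<close> allows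
  removing the factor \<open>cnj a ^ k\<close> in it.\<close>

lemma A_le_if_test_norms_le:
  assumes d: "(\<Sum>i=1..4. d i * pochhammer (real i) k) = 1"
      "\<And>l. l \<in> orders - {k} \<Longrightarrow> (\<Sum>i=1..4. d i * pochhammer (real i) l) = 0"
    and k: "k \<in> orders" and w: "w \<in> disk" "cmod (\<phi> w) > 1 / 2" and c: "c \<ge> 0"
    and le: "\<And>i. i \<in> {1..4} \<Longrightarrow> Bloch_norm \<mu> (T (f_test i (\<phi> w))) \<le> ennreal c"
  shows "A k w \<le> (2 ^ k * (\<Sum>i=1..4. \<bar>d i\<bar> * 2 ^ i)) * c"
proof -
  define a where "a = \<phi> w"
  have a: "cmod a < 1" "1 / 2 < cmod a" using phi_disk[OF w(1)] w(2) by (auto simp: a_def)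
  have ad: "a \<in> disk" using a by simp
  \<comment> \<open>The test functions are normalised by \<open>1 - cmod a\<close>, while their
    denominators at \<open>a\<close> are \<open>1 - (cmod a)\<^sup>2\<close>. The factor
    \<open>u ^ i\<close> compensates for the difference.\<close>
  define u where "u = complex_of_real (1 + cmod a)"
  define v where "v = complex_of_real (1 - cmod a)"
  define q where "q = complex_of_real (1 - (cmod a)\<^sup>2)"
  have v0: "v \<noteq> 0" using a by (auto simp: v_def simp del: of_real_diff)
  have u0: "u \<noteq> 0" using a by (auto simp: u_def simp del: of_real_add)
  have quv: "q = u * v" by (simp add: q_def u_def v_def power2_eq_square algebra_simps)
  have den: "1 - cnj a * a = q" by (simp add: q_def mult.commute complex_norm_square del: of_real_power)
  define X where "X l = cnj a ^ l * E l w / q ^ l" for l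
  have "u ^ i * deriv (T (f_test i a)) w = (\<Sum>l\<in>orders. of_real (pochhammer (real i) l) * X l)" for i
  proof -
    have "deriv (T (f_test i a)) w = (\<Sum>l\<in>orders. E l w * (deriv ^^ l) (f_test i a) a)"
      unfolding a_def by (rule deriv_T[OF HinfD(1)[OF f_test_Hinf(1)] w(1)]) (use a in \<open>simp add: a_def\<close>)
    also have "\<dots> = (\<Sum>l\<in>orders. E l w * (pochhammer (of_nat i) l * cnj a ^ l * v ^ i / q ^ (i + l)))"
      unfolding f_test_Hinf(4)[OF a(1) ad] den by (simp add: v_def)
    finally have "u ^ i * deriv (T (f_test i a)) w
      = (\<Sum>l\<in>orders. u ^ i * (E l w * (pochhammer (of_nat i) l * cnj a ^ l * v ^ i / q ^ (i + l))))"
      by (simp only: sum_distrib_left)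
    also have "\<dots> = (\<Sum>l\<in>orders. of_real (pochhammer (real i) l) * X l)"
    proof (rule sum.cong[OF refl])
      fix l
      have "u ^ i * v ^ i / q ^ (i + l) = 1 / q ^ l"
        using u0 v0 by (simp add: quv power_add power_mult_distrib)
      moreover have "complex_of_real (pochhammer (real i) l) = pochhammer (of_nat i) l"
        by (simp add: pochhammer_of_real[symmetric])
      moreover have "u ^ i * (E l w * (pochhammer (of_nat i) l * cnj a ^ l * v ^ i / q ^ (i + l)))
          = (u ^ i * v ^ i / q ^ (i + l)) * (pochhammer (of_nat i) l * (cnj a ^ l * E l w))"
        by (simp add: mult_ac)
      ultimately show "u ^ i * (E l w * (pochhammer (of_nat i) l * cnj a ^ l * v ^ i / q ^ (i + l)))
          = of_real (pochhammer (real i) l) * X l"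
        by (simp add: X_def)
    qed
    finally show ?thesis .
  qed
  then have "(\<Sum>i=1..4. of_real (d i) * (u ^ i * deriv (T (f_test i a)) w))
      = (\<Sum>i=1..4. \<Sum>l\<in>orders. of_real (d i) * (of_real (pochhammer (real i) l) * X l))"
    by (simp only: sum_distrib_left)
  also have "\<dots> = (\<Sum>l\<in>orders. \<Sum>i=1..4. of_real (d i) * (of_real (pochhammer (real i) l) * X l))"
    by (rule sum.swap)
  also have "\<dots> = (\<Sum>l\<in>orders. of_real (\<Sum>i=1..4. d i * pochhammer (real i) l) * X l)"
    by (simp only: of_real_sum of_real_mult sum_distrib_right mult.assoc)
  also have "\<dots> = (\<Sum>l\<in>orders. if l = k then X k else 0)"
  proof (rule sum.cong[OF refl])
    fix l assume "l \<in> orders"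
    then show "of_real (\<Sum>i=1..4. d i * pochhammer (real i) l) * X l = (if l = k then X k else 0)"
      using d(1) d(2)[of l] by (cases "l = k") simp_all
  qed
  also have "\<dots> = X k" using k by (subst sum.delta) auto
  finally have X: "X k = (\<Sum>i=1..4. of_real (d i) * (u ^ i * deriv (T (f_test i a)) w))" by simp
  have \<mu>0: "\<mu> w \<ge> 0" using weight_pos[OF w(1)] by simp
  have "\<mu> w * cmod (X k) \<le> \<mu> w * (\<Sum>i=1..4. \<bar>d i\<bar> * (2 ^ i * cmod (deriv (T (f_test i a)) w)))"
    unfolding X
  proof (intro mult_left_mono sum_norm_le \<mu>0)
    fix i
    have "cmod u ^ i \<le> 2 ^ i" using a by (intro power_mono) (auto simp: u_def norm_of_real simp del: of_real_add)
    then show "cmod (of_real (d i) * (u ^ i * deriv (T (f_test i a)) w)) \<le> \<bar>d i\<bar> * (2 ^ i * cmod (deriv (T (f_test i a)) w))"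
      unfolding norm_mult norm_power norm_of_real by (intro mult_left_mono mult_right_mono) auto
  qed
  also have "\<dots> = (\<Sum>i=1..4. \<bar>d i\<bar> * 2 ^ i * (\<mu> w * cmod (deriv (T (f_test i a)) w)))"
    by (simp only: sum_distrib_left mult_ac)
  also have "\<dots> \<le> (\<Sum>i=1..4. \<bar>d i\<bar> * 2 ^ i * c)"
    using Bloch_norm_leD(2)[OF le c w(1)] by (intro sum_mono mult_left_mono) (auto simp: a_def)
  also have "\<dots> = (\<Sum>i=1..4. \<bar>d i\<bar> * 2 ^ i) * c" by (simp only: sum_distrib_right)
  finally have X_le: "\<mu> w * cmod (X k) \<le> (\<Sum>i=1..4. \<bar>d i\<bar> * 2 ^ i) * c" .
  have "\<mu> w * cmod (X k) = cmod a ^ k * A k w"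
    using one_minus_phi_sq[OF w(1)] unfolding X_def A_def q_def a_def
    by (simp add: norm_mult norm_divide norm_power del: of_real_diff)
  then have "2 ^ k * (cmod a ^ k * A k w) \<le> 2 ^ k * ((\<Sum>i=1..4. \<bar>d i\<bar> * 2 ^ i) * c)"
    using X_le by simp
  moreover have "1 * A k w \<le> (2 * cmod a) ^ k * A k w"
    using A_nonneg[OF w(1)] a by (intro mult_right_mono one_le_power) auto
  ultimately show ?thesis
    unfolding power_mult_distrib mult_1 mult.assoc by (rule order.trans[rotated])
qed

text \<open>The estimate at a single point holds for all \<open>w\<close> beyond a common threshold:
  1/2 for removing powers of \<open>cnj a\<close>, and the maximum of the thresholds at which the
  four test norms drop to \<open>c\<close>.\<close>

lemma boundary_size_le_test_size:
  assumes C: "C > 0"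
    and d: "\<And>k. k \<in> orders \<Longrightarrow> \<exists>d :: nat \<Rightarrow> real. (\<Sum>i=1..4. d i * pochhammer (real i) k) = 1 \<and>
      (\<forall>l\<in>orders - {k}. (\<Sum>i=1..4. d i * pochhammer (real i) l) = 0) \<and>
      2 ^ k * (\<Sum>i=1..4. \<bar>d i\<bar> * 2 ^ i) \<le> C"
  shows "boundary_size \<le> ennreal C * test_size"
proof -
  have "limsup_to_bdry \<phi> (\<lambda>z. ennreal (A k z)) \<le> ennreal C * test_size" if k: "k \<in> orders" for k
  proof (rule le_ennreal_mult_if_above[OF C])
    fix c :: real assume c: "c > 0" "test_size < ennreal c"
    obtain d where d: "(\<Sum>i=1..4. d i * pochhammer (real i) k) = 1"
      "\<And>l. l \<in> orders - {k} \<Longrightarrow> (\<Sum>i=1..4. d i * pochhammer (real i) l) = 0"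
      "2 ^ k * (\<Sum>i=1..4. \<bar>d i\<bar> * 2 ^ i) \<le> C" using d[OF k] by blast
    have "\<exists>\<delta><1. \<forall>w\<in>disk. cmod (\<phi> w) > \<delta> \<longrightarrow> Bloch_norm \<mu> (T (f_test i (\<phi> w))) \<le> ennreal c" if i: "i \<in> {1..4}" for i
    proof -
      have "limsup_to_bdry \<phi> (\<lambda>w. Bloch_norm \<mu> (T (f_test i (\<phi> w)))) \<le> test_size"
        unfolding test_size_def by (rule Max_ge[OF _ imageI[OF i]]) simp
      then have "limsup_to_bdry \<phi> (\<lambda>w. Bloch_norm \<mu> (T (f_test i (\<phi> w)))) < ennreal c"
        using c(2) by (rule le_less_trans)
      then show ?thesis by (rule limsup_to_bdry_lessD) blast
    qed
    then obtain \<delta> where \<delta>: "\<And>i. i \<in> {1..4::nat} \<Longrightarrow> \<delta> i < 1"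
      "\<And>i w. i \<in> {1..4::nat} \<Longrightarrow> w \<in> disk \<Longrightarrow> cmod (\<phi> w) > \<delta> i \<Longrightarrow> Bloch_norm \<mu> (T (f_test i (\<phi> w))) \<le> ennreal c"
      by metis
    define \<delta>' where "\<delta>' = max (1 / 2) (Max (\<delta> ` {1..4}))"
    show "limsup_to_bdry \<phi> (\<lambda>z. ennreal (A k z)) \<le> ennreal (C * c)"
    proof (rule limsup_to_bdry_le)
      show "\<delta>' < 1" unfolding \<delta>'_def using \<delta>(1) by (simp add: Max_less_iff del: atLeastAtMost_iff)
      fix w assume w: "w \<in> disk" "cmod (\<phi> w) > \<delta>'"
      have "A k w \<le> (2 ^ k * (\<Sum>i=1..4. \<bar>d i\<bar> * 2 ^ i)) * c"
      proof (rule A_le_if_test_norms_le[OF d(1,2) k w(1)])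
        show "Bloch_norm \<mu> (T (f_test i (\<phi> w))) \<le> ennreal c" if i: "i \<in> {1..4}" for i
        proof (rule \<delta>(2)[OF i w(1)])
          have "\<delta> i \<le> Max (\<delta> ` {1..4})" by (rule Max_ge[OF _ imageI[OF i]]) simp
          also have "\<dots> \<le> \<delta>'" unfolding \<delta>'_def by (rule max.cobounded2)
          also note w(2)
          finally show "\<delta> i < cmod (\<phi> w)" .
        qed
      qed (use w(2) c(1) in \<open>auto simp: \<delta>'_def\<close>)
      also have "\<dots> \<le> C * c" using d(3) c(1) by (intro mult_right_mono) auto
      finally show "ennreal (A k w) \<le> ennreal (C * c)" by (rule ennreal_leI)
    qed
  qed
  then show ?thesis unfolding boundary_size_def by (subst Max_le_iff) auto
qed

section \<open>Upper bound for the essential norm\<close>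

abbreviation "dist_norm_T L \<equiv> op_norm Hinf Hinf_norm (Bloch_norm \<mu>) (\<lambda>f z. T f z - L f z)"

lemma Bloch_sum: "(\<And>j. g j \<in> Bloch \<mu>) \<Longrightarrow> (\<lambda>z. \<Sum>j<N. c j * g j z) \<in> Bloch \<mu>" for N :: nat
proof (induction N)
  case 0
  show ?case using Bloch_zero by simp
next
  case (Suc N)
  then show ?case using Bloch_add[of "\<lambda>z. \<Sum>j<N. c j * g j z" "\<lambda>z. c N * g N z"] by (simp add: Bloch_cmult)
qed

text \<open>Coefficient functionals bounded by 1 on the unit ball put its image into the compact set
  of combinations of the \<open>g j\<close> with such coefficients.\<close>

lemma compact_operator_finite_rank:
  fixes c :: "nat \<Rightarrow> (complex \<Rightarrow> complex) \<Rightarrow> complex"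
  assumes g: "\<And>j. g j \<in> Bloch \<mu>"
    and add: "\<And>j f h. f \<in> Hinf \<Longrightarrow> h \<in> Hinf \<Longrightarrow> c j (\<lambda>z. f z + h z) = c j f + c j h"
    and cmult: "\<And>j f a. f \<in> Hinf \<Longrightarrow> c j (\<lambda>z. a * f z) = a * c j f"
    and le: "\<And>j f. f \<in> Hinf \<Longrightarrow> Hinf_norm f \<le> 1 \<Longrightarrow> cmod (c j f) \<le> 1"
  shows "compact_operator Hinf Hinf_norm (Bloch \<mu>) (Bloch_norm \<mu>) (\<lambda>f z. \<Sum>j<N. c j f * g j z)"
proof (rule compact_operator_if_image_subset[OF _ compactin_unit_combinations[OF g, where N = N]])
  show "linear_operator Hinf (Bloch \<mu>) (\<lambda>f z. \<Sum>j<N. c j f * g j z)"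
    unfolding linear_operator_def
    by (simp add: Bloch_sum g add cmult distrib_right sum.distrib sum_distrib_left mult.assoc)
  show "(\<lambda>f z. \<Sum>j<N. c j f * g j z) ` {f \<in> Hinf. Hinf_norm f \<le> 1}
      \<subseteq> {\<lambda>z. \<Sum>j<N. c j * g j z | c. \<forall>j<N. cmod (c j) \<le> 1}"
  proof (rule image_subsetI)
    fix f assume "f \<in> {f \<in> Hinf. Hinf_norm f \<le> 1}"
    then show "(\<lambda>z. \<Sum>j<N. c j f * g j z) \<in> {\<lambda>z. \<Sum>j<N. c j * g j z | c. \<forall>j<N. cmod (c j) \<le> 1}"
      unfolding mem_Collect_eq by (intro exI[of _ "\<lambda>j. c j f"]) (simp add: le)
  qed
qed

text \<open>The compact competitor sends \<open>f\<close> to the image under \<open>T\<close> of a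
  Taylor polynomial \<open>p\<close> of a dilation of \<open>f\<close>. The remainder
  \<open>f - p\<close> is bounded by 3 and small on a compact disk, which explains the factor
  3.\<close>

lemma essential_norm_le:
  "essential_norm Hinf Hinf_norm (Bloch \<mu>) (Bloch_norm \<mu>) T \<le> ennreal (3 * C1) * boundary_size"
proof (rule le_ennreal_mult_if_above)
  show "0 < 3 * C1" using growth_bound_pos[of m n] by simp
  fix c :: real assume c: "c > 0" "boundary_size < ennreal c"
  obtain \<delta> where \<delta>: "\<delta> < 1" "\<And>k z. k \<in> orders \<Longrightarrow> z \<in> disk \<Longrightarrow> cmod (\<phi> z) > \<delta> \<Longrightarrow> A k z \<le> c"
    using boundary_size_less[OF c(2)] by blast
  obtain \<eta> \<rho> where \<eta>: "\<eta> > 0" and \<rho>: "0 \<le> \<rho>" "\<rho> < 1"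
    and small: "\<And>f. f holomorphic_on disk \<Longrightarrow> (\<And>z. z \<in> disk \<Longrightarrow> cmod (f z) \<le> 1) \<Longrightarrow>
      (\<And>z. cmod z \<le> \<rho> \<Longrightarrow> cmod (f z) \<le> \<eta>) \<Longrightarrow> Bloch_norm \<mu> (T f) \<le> ennreal (C1 * c)"
    using Bloch_norm_T_le_if_small_inside[OF c(1) \<delta>] by blast
  obtain s :: real and N :: nat where approx:
    "\<And>f j. f holomorphic_on disk \<Longrightarrow> (\<And>z. z \<in> disk \<Longrightarrow> cmod (f z) \<le> 1) \<Longrightarrow>
       cmod ((deriv ^^ j) f 0 / fact j * of_real s ^ j) \<le> 1"
    "\<And>f z. f holomorphic_on disk \<Longrightarrow> (\<And>z. z \<in> disk \<Longrightarrow> cmod (f z) \<le> 1) \<Longrightarrow> z \<in> disk \<Longrightarrow>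
       cmod (f z - (\<Sum>j<N. (deriv ^^ j) f 0 / fact j * of_real s ^ j * z ^ j)) \<le> 3"
    "\<And>f z. f holomorphic_on disk \<Longrightarrow> (\<And>z. z \<in> disk \<Longrightarrow> cmod (f z) \<le> 1) \<Longrightarrow> cmod z \<le> \<rho> \<Longrightarrow>
       cmod (f z - (\<Sum>j<N. (deriv ^^ j) f 0 / fact j * of_real s ^ j * z ^ j)) \<le> \<eta>"
    using ex_finite_rank_approximation[OF \<rho> \<eta>] by blast
  define a :: "nat \<Rightarrow> (complex \<Rightarrow> complex) \<Rightarrow> complex" where "a j f = (deriv ^^ j) f 0 / fact j * of_real s ^ j" for j f
  define e :: "nat \<Rightarrow> complex \<Rightarrow> complex" where "e j = on_disk (\<lambda>z. z ^ j)" for j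
  \<comment> \<open>Written through the images of the monomials, \<open>L\<close> visibly has finite
    rank; linearity later identifies \<open>L f\<close> with \<open>T p\<close>.\<close>
  define L :: operator where "L f = (\<lambda>z. \<Sum>j<N. a j f * T (e j) z)" for f
  have e: "e j \<in> Hinf" for j
    unfolding e_def by (rule on_disk_Hinf(1)[of _ 1]) (auto intro!: holomorphic_intros simp: norm_power power_le_one)
  have "compact_operator Hinf Hinf_norm (Bloch \<mu>) (Bloch_norm \<mu>) L"
    unfolding L_def
  proof (rule compact_operator_finite_rank)
    show "T (e j) \<in> Bloch \<mu>" for j by (rule T_in_Bloch[OF e])
    fix j f h and b :: complex
    assume f: "f \<in> Hinf"
    show "a j (\<lambda>z. b * f z) = b * a j f"
      unfolding a_def by (subst higher_deriv_cmult[OF HinfD(1)[OF f]]) auto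
    show "cmod (a j f) \<le> 1" if "Hinf_norm f \<le> 1"
      unfolding a_def by (rule approx(1)[OF HinfD(1)[OF f] Hinf_norm_le_1D[OF that]])
    assume h: "h \<in> Hinf"
    show "a j (\<lambda>z. f z + h z) = a j f + a j h"
      unfolding a_def
      by (subst higher_deriv_add[OF HinfD(1)[OF f] HinfD(1)[OF h]]) (auto simp: add_divide_distrib distrib_right)
  qed
  then have "essential_norm Hinf Hinf_norm (Bloch \<mu>) (Bloch_norm \<mu>) T \<le> dist_norm_T L"
    unfolding essential_norm_def by (intro INF_lower) simp
  also have "\<dots> \<le> ennreal (3 * C1 * c)"
    unfolding op_norm_def
  proof (rule SUP_least)
    fix f assume "f \<in> {f \<in> Hinf. Hinf_norm f \<le> 1}"
    then have f: "f \<in> Hinf" "\<And>z. z \<in> disk \<Longrightarrow> cmod (f z) \<le> 1"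
      by (auto intro: Hinf_norm_le_1D simp del: mem_ball_0)
    define p where "p = (\<lambda>z. \<Sum>j<N. a j f * e j z)"
    have p: "p \<in> Hinf" unfolding p_def by (rule Hinf_sum[OF e])
    have p_eq: "p z = (\<Sum>j<N. (deriv ^^ j) f 0 / fact j * of_real s ^ j * z ^ j)" if "z \<in> disk" for z
      using that by (simp add: p_def a_def e_def on_disk_def)
    \<comment> \<open>The factor 1/3 brings the remainder into the unit ball, as
      \<open>small\<close> requires.\<close>
    define g where "g = (\<lambda>z. 1 / 3 * (f z - p z))"
    have Tg: "T g = (\<lambda>z. 1 / 3 * (T f z - T p z))"
      unfolding g_def by (rule linear_operator_cmult_diff[OF linear_T f(1) p])
    have "T p = L f"
      unfolding p_def L_def by (rule linear_operator_sum[OF linear_T e])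
    then have eq: "(\<lambda>z. T f z - L f z) = (\<lambda>z. 3 * T g z)" by (simp add: Tg fun_eq_iff diff_divide_distrib)
    have holg: "g holomorphic_on disk"
      unfolding g_def by (intro holomorphic_intros HinfD(1) f p) 
    have "Bloch_norm \<mu> (T g) \<le> ennreal (C1 * c)"
    proof (rule small[OF holg])
      show "cmod (g z) \<le> 1" if z: "z \<in> disk" for z
        using approx(2)[OF HinfD(1)[OF f(1)] f(2) z] p_eq[OF z] by (simp add: g_def norm_divide)
      show "cmod (g z) \<le> \<eta>" if z: "cmod z \<le> \<rho>" for z
      proof -
        have "z \<in> disk" using z \<rho> by simp
        then show ?thesis
          using approx(3)[OF HinfD(1)[OF f(1)] f(2) z] p_eq[of z] \<eta> by (simp add: g_def norm_divide)
      qed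
    qed
    moreover have "g \<in> Hinf"
    proof -
      have "(\<lambda>z. 1 / 3 * (f z + (-1) * p z)) \<in> Hinf" by (intro Hinf_cmult Hinf_add f(1) p)
      then show ?thesis by (simp add: g_def)
    qed
    then have "Bloch_norm \<mu> (\<lambda>z. 3 * T g z) = ennreal 3 * Bloch_norm \<mu> (T g)"
      by (subst Bloch_norm_cmult[OF Bloch_disk_analytic[OF T_in_Bloch]]) auto
    ultimately have "Bloch_norm \<mu> (\<lambda>z. 3 * T g z) \<le> ennreal 3 * ennreal (C1 * c)"
      by (simp only: mult_left_mono zero_le)
    also have "\<dots> = ennreal (3 * C1 * c)"
      using growth_bound_pos[of m n] c by (simp add: ennreal_mult[symmetric] mult.assoc del: ennreal_numeral)
    finally show "Bloch_norm \<mu> (\<lambda>z. T f z - L f z) \<le> ennreal (3 * C1 * c)" unfolding eq .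
  qed
  finally show "essential_norm Hinf Hinf_norm (Bloch \<mu>) (Bloch_norm \<mu>) T \<le> ennreal (3 * C1 * c)" .
qed

section \<open>Lower bound for the essential norm\<close>

text \<open>The coefficients \<open>A k\<close> are uniformly bounded, so the decay of the weighted
  derivatives of \<open>H\<close> at \<open>\<zeta>\<close> dominates. The points
  \<open>\<phi> (z j)\<close> lie in the open disk and so differ from \<open>\<zeta>\<close>, as the
  punctured limit demands.\<close>

lemma weighted_deriv_T_tendsto_0:
  assumes H: "H \<in> Hinf"
    and lim: "\<And>i. ((\<lambda>w. (1 - (cmod w)\<^sup>2) ^ i * cmod ((deriv ^^ i) H w)) \<longlongrightarrow> 0) (at \<zeta> within disk)"
    and z: "\<And>j. z j \<in> disk" "(\<lambda>j. \<phi> (z j)) \<longlonglongrightarrow> \<zeta>" and \<zeta>: "cmod \<zeta> = 1"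
  shows "(\<lambda>j::nat. \<mu> (z j) * cmod (deriv (T H) (z j))) \<longlonglongrightarrow> 0"
proof -
  obtain B where B: "B \<ge> 0" "\<And>k z. k \<in> orders \<Longrightarrow> z \<in> disk \<Longrightarrow> A k z \<le> B"
    using A_bounded by blast
  have "filterlim (\<lambda>j. \<phi> (z j)) (at \<zeta> within disk) sequentially"
    unfolding filterlim_at
  proof (intro conjI always_eventually allI z(2))
    fix j
    show "\<phi> (z j) \<in> disk" by (rule phi_disk[OF z(1)])
    then show "\<phi> (z j) \<noteq> \<zeta>" using \<zeta> by auto
  qed
  note lim' = filterlim_compose[OF lim this]
  have "(\<lambda>j. \<Sum>k\<in>orders. B * ((1 - (cmod (\<phi> (z j)))\<^sup>2) ^ k * cmod ((deriv ^^ k) H (\<phi> (z j))))) \<longlonglongrightarrow> (\<Sum>k\<in>orders. B * 0)"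
    by (intro tendsto_intros lim')
  then have lim0: "(\<lambda>j. \<Sum>k\<in>orders. B * ((1 - (cmod (\<phi> (z j)))\<^sup>2) ^ k * cmod ((deriv ^^ k) H (\<phi> (z j))))) \<longlonglongrightarrow> 0"
    by simp
  show ?thesis
  proof (rule tendsto_sandwich[OF _ _ tendsto_const lim0])
    show "eventually (\<lambda>j. 0 \<le> \<mu> (z j) * cmod (deriv (T H) (z j))) sequentially"
      using weight_pos[OF z(1)] by (intro always_eventually allI mult_nonneg_nonneg) (auto intro: less_imp_le)
    have "\<mu> (z j) * cmod (deriv (T H) (z j))
        \<le> (\<Sum>k\<in>orders. B * ((1 - (cmod (\<phi> (z j)))\<^sup>2) ^ k * cmod ((deriv ^^ k) H (\<phi> (z j)))))" for j
      by (intro order.trans[OF weighted_deriv_T_le[OF HinfD(1)[OF H] z(1)]] sum_mono mult_right_mono B(2) z(1))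
         (assumption, intro mult_nonneg_nonneg zero_le_power norm_ge_zero less_imp_le[OF one_minus_phi_sq(1)[OF z(1)]])
    then show "eventually (\<lambda>j. \<mu> (z j) * cmod (deriv (T H) (z j))
        \<le> (\<Sum>k\<in>orders. B * ((1 - (cmod (\<phi> (z j)))\<^sup>2) ^ k * cmod ((deriv ^^ k) H (\<phi> (z j)))))) sequentially"
      by (intro always_eventually allI)
  qed
qed

text \<open>By contradiction: choose points with large \<open>A k\<close> whose images under
  \<open>\<phi>\<close> tend to some \<open>\<zeta>\<close> on the circle, and peak functions at
  these points. Half the difference of two of them tests \<open>T - L\<close>: compactness makes the
  \<open>L\<close> part small, and the decay at \<open>\<zeta>\<close> removes the contribution of
  the function with fixed index.\<close>

lemma limsup_A_le_dist_compact:
  assumes L: "compact_operator Hinf Hinf_norm (Bloch \<mu>) (Bloch_norm \<mu>) L" and k: "k \<in> orders"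
  shows "limsup_to_bdry \<phi> (\<lambda>z. ennreal (A k z)) \<le> ennreal (2 * K) * dist_norm_T L"
proof (rule le_ennreal_mult_if_above)
  show "2 * K > 0" using peak_bound_pos[of n] by simp
  fix c :: real assume c: "c > 0" "dist_norm_T L < ennreal c"
  \<comment> \<open>The gap \<open>c - N\<close> is the tolerance granted to each of the two error
    terms.\<close>
  obtain N where N: "dist_norm_T L = ennreal N" "0 \<le> N" "N < c"
    using c by (cases "dist_norm_T L") (auto simp: ennreal_less_iff)
  have linL: "linear_operator Hinf (Bloch \<mu>) L" using L by (simp add: compact_operator_def)
  show "limsup_to_bdry \<phi> (\<lambda>z. ennreal (A k z)) \<le> ennreal (2 * K * c)"
  proof (rule ccontr)
    assume "\<not> limsup_to_bdry \<phi> (\<lambda>z. ennreal (A k z)) \<le> ennreal (2 * K * c)"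
    then have large: "ennreal (2 * K * c) < limsup_to_bdry \<phi> (\<lambda>z. ennreal (A k z))" by simp
    have "\<exists>z. z \<in> disk \<and> 1 - inverse (real (Suc j)) < cmod (\<phi> z) \<and> 2 * K * c < A k z" for j
    proof -
      have "1 - inverse (real (Suc j)) < 1" by simp
      from limsup_to_bdry_greaterD[OF large this] obtain z where
        "z \<in> disk" "1 - inverse (real (Suc j)) < cmod (\<phi> z)" "ennreal (2 * K * c) < ennreal (A k z)" by blast
      moreover have "0 \<le> 2 * K * c" using peak_bound_pos[of n] c by simp
      ultimately show ?thesis by (auto simp: ennreal_less_iff simp del: mem_ball_0)
    qed
    then have "\<forall>j. \<exists>z. z \<in> disk \<and> 1 - inverse (real (Suc j)) < cmod (\<phi> z) \<and> 2 * K * c < A k z" by blast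
    from choice[OF this] obtain z where z: "\<And>j. z j \<in> disk" "\<And>j. 1 - inverse (real (Suc j)) < cmod (\<phi> (z j))"
      "\<And>j. 2 * K * c < A k (z j)" by blast
    have "(\<lambda>j. 1 - inverse (real (Suc j))) \<longlonglongrightarrow> 1 - 0"
      by (intro tendsto_intros LIMSEQ_inverse_real_of_nat)
    then have lim1: "(\<lambda>j. 1 - inverse (real (Suc j))) \<longlonglongrightarrow> 1" by simp
    have norm1: "(\<lambda>j. cmod (\<phi> (z j))) \<longlonglongrightarrow> 1"
    proof (rule tendsto_sandwich[OF _ _ lim1 tendsto_const])
      show "eventually (\<lambda>j. 1 - inverse (real (Suc j)) \<le> cmod (\<phi> (z j))) sequentially"
        using z(2) by (intro always_eventually allI less_imp_le)
      show "eventually (\<lambda>j. cmod (\<phi> (z j)) \<le> 1) sequentially"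
        using phi_disk[OF z(1)] by (intro always_eventually allI) (auto intro: less_imp_le)
    qed
    have "\<phi> (z j) \<in> cball 0 1" for j using phi_disk[OF z(1)[of j]] by (auto intro: less_imp_le)
    then have "\<exists>l\<in>cball 0 1. \<exists>r. strict_mono (r :: nat \<Rightarrow> nat) \<and> ((\<lambda>j. \<phi> (z j)) \<circ> r) \<longlonglongrightarrow> l"
      by (rule compact_cball[of "0::complex" 1, unfolded compact_def, rule_format])
    then obtain \<zeta> r0 where r0: "strict_mono r0" "((\<lambda>j. \<phi> (z j)) \<circ> r0) \<longlonglongrightarrow> \<zeta>"
      by blast
    have "((\<lambda>j. cmod (\<phi> (z j))) \<circ> r0) \<longlonglongrightarrow> 1" by (rule LIMSEQ_subseq_LIMSEQ[OF norm1 r0(1)])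
    moreover have "((\<lambda>j. cmod (\<phi> (z j))) \<circ> r0) \<longlonglongrightarrow> cmod \<zeta>"
      using tendsto_norm[OF r0(2)] by (simp add: o_def)
    ultimately have \<zeta>: "cmod \<zeta> = 1" by (rule LIMSEQ_unique[symmetric])
    define y where "y j = z (r0 j)" for j
    have y: "y j \<in> disk" "2 * K * c < A k (y j)" for j using z by (simp_all add: y_def)
    have y_lim: "(\<lambda>j. \<phi> (y j)) \<longlonglongrightarrow> \<zeta>" using r0(2) by (simp add: o_def y_def)
    let ?peak = "\<lambda>j H. H \<in> Hinf \<and> (\<forall>w\<in>disk. cmod (H w) \<le> 1) \<and> A k (y j) \<le> K * (\<mu> (y j) * cmod (deriv (T H) (y j))) \<and>
      (\<forall>i. ((\<lambda>w. (1 - (cmod w)\<^sup>2) ^ i * cmod ((deriv ^^ i) H w)) \<longlongrightarrow> 0) (at \<zeta> within disk))"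
    have "\<forall>j. \<exists>H. ?peak j H"
    proof
      fix j
      show "\<exists>H. ?peak j H" by (rule ex_peak_function[OF y(1) \<zeta> k, of j]) blast
    qed
    from choice[OF this] obtain H where "\<forall>j. ?peak j (H j)" ..
    then have H: "\<And>j. H j \<in> Hinf" "\<And>j w. w \<in> disk \<Longrightarrow> cmod (H j w) \<le> 1"
      "\<And>j. A k (y j) \<le> K * (\<mu> (y j) * cmod (deriv (T (H j)) (y j)))"
      "\<And>i j. ((\<lambda>w. (1 - (cmod w)\<^sup>2) ^ i * cmod ((deriv ^^ i) (H j) w)) \<longlongrightarrow> 0) (at \<zeta> within disk)"
      by (simp_all del: mem_ball_0)
    have H_norm: "Hinf_norm (H j) \<le> 1" for j
      using Hinf_I(2)[of "H j" 1] HinfD(1)[OF H(1)] H(2) Hinf_vanishes[OF H(1)] by (simp del: mem_ball_0)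
    obtain r :: "nat \<Rightarrow> nat" where r: "strict_mono r"
      "\<And>e. e > 0 \<Longrightarrow> \<exists>M. \<forall>i\<ge>M. \<forall>j\<ge>M. bnorm (\<lambda>z. L (H (r i)) z - L (H (r j)) z) < e"
    proof (rule compact_operator_subseq[where h = H, OF L H(1) H_norm])
      fix r :: "nat \<Rightarrow> nat"
      assume "strict_mono r"
        "\<And>e. e > 0 \<Longrightarrow> \<exists>M. \<forall>i\<ge>M. \<forall>j\<ge>M. bnorm (\<lambda>z. L (H (r i)) z - L (H (r j)) z) < e"
      then show thesis by (rule that)
    qed
    obtain M where M: "\<And>i j. i \<ge> M \<Longrightarrow> j \<ge> M \<Longrightarrow> bnorm (\<lambda>z. L (H (r i)) z - L (H (r j)) z) < c - N"
      using r(2)[of "c - N"] N(3) by auto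
    \<comment> \<open>The index \<open>M\<close> is now frozen and only the other one tends to
      infinity, so the decay of \<open>H (r M)\<close> at \<open>\<zeta>\<close> can be
      used.\<close>
    have "(\<lambda>j. \<phi> (y (r j))) \<longlonglongrightarrow> \<zeta>"
      using LIMSEQ_subseq_LIMSEQ[OF y_lim r(1)] by (simp add: o_def)
    then have "(\<lambda>j. \<mu> (y (r j)) * cmod (deriv (T (H (r M))) (y (r j)))) \<longlonglongrightarrow> 0"
      by (intro weighted_deriv_T_tendsto_0[OF H(1) H(4) y(1) _ \<zeta>])
    then have "eventually (\<lambda>j. \<mu> (y (r j)) * cmod (deriv (T (H (r M))) (y (r j))) < c - N) sequentially"
      using N(3) by (intro order_tendstoD) auto
    then obtain M' where "\<And>j. j \<ge> M' \<Longrightarrow> \<mu> (y (r j)) * cmod (deriv (T (H (r M))) (y (r j))) < c - N"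
      by (auto simp: eventually_sequentially)
    then obtain j where j: "j \<ge> M" "\<mu> (y (r j)) * cmod (deriv (T (H (r M))) (y (r j))) < c - N"
      by (meson max.cobounded1 max.cobounded2)
    define x where "x = y (r j)"
    define h where "h = H (r j)"
    define g where "g = H (r M)"
    have hg: "h \<in> Hinf" "g \<in> Hinf" by (simp_all add: h_def g_def H)
    have x: "x \<in> disk" unfolding x_def by (rule y(1))
    have \<mu>0: "\<mu> x > 0" by (rule weight_pos[OF x])
    \<comment> \<open>Halving keeps the difference in the unit ball and is the source of the 2 in
      the constant \<open>2 * K\<close>.\<close>
    define f where "f = (\<lambda>z. 1 / 2 * (h z - g z))"
    have f: "f \<in> Hinf" "Hinf_norm f \<le> ennreal 1"
    proof (rule_tac [!] Hinf_I)
      show "f holomorphic_on disk" "f holomorphic_on disk"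
        unfolding f_def by (intro holomorphic_intros HinfD(1) hg)+
      show "f z = 0" "f z = 0" if "z \<notin> disk" for z
        using that by (simp_all add: f_def Hinf_vanishes hg del: mem_ball_0)
      show "cmod (f z) \<le> 1" "cmod (f z) \<le> 1" if "z \<in> disk" for z
      proof -
        have "cmod (h z - g z) \<le> 1 + 1"
          using H(2)[OF that] by (intro order.trans[OF norm_triangle_ineq4] add_mono) (simp_all add: h_def g_def)
        then show "cmod (f z) \<le> 1" "cmod (f z) \<le> 1" by (simp_all add: f_def norm_divide)
      qed
    qed simp_all
    have "Bloch_norm \<mu> (\<lambda>z. T f z - L f z) \<le> ennreal N"
      unfolding N(1)[symmetric] op_norm_def using f by (intro SUP_upper) simp
    then have le_N: "\<mu> x * cmod (deriv (\<lambda>z. T f z - L f z) x) \<le> N"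
      using N(2) x by (rule Bloch_norm_leD(2))
    have Bl: "T h \<in> Bloch \<mu>" "T g \<in> Bloch \<mu>" "L h \<in> Bloch \<mu>" "L g \<in> Bloch \<mu>"
      using hg linear_operatorD(1)[OF linL] by (simp_all add: T_in_Bloch)
    define D where "D = deriv (\<lambda>z. L h z - L g z) x"
    have LB: "(\<lambda>z. L h z - L g z) \<in> Bloch \<mu>" by (rule Bloch_diff[OF Bl(3,4)])
    have der: "(F has_field_derivative deriv F x) (at x)" if "F \<in> Bloch \<mu>" for F
      using disk_analytic_field_differentiable[OF Bloch_disk_analytic[OF that] x]
      by (simp add: DERIV_deriv_iff_field_differentiable)
    have "(\<lambda>z. T f z - L f z) = (\<lambda>z. 1 / 2 * ((T h z - T g z) - (L h z - L g z)))"
      unfolding f_def linear_operator_cmult_diff[OF linear_T hg] linear_operator_cmult_diff[OF linL hg]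
      by (simp add: fun_eq_iff diff_divide_distrib)
    moreover have "((\<lambda>z. 1 / 2 * ((T h z - T g z) - (L h z - L g z))) has_field_derivative
        1 / 2 * ((deriv (T h) x - deriv (T g) x) - D)) (at x)"
      unfolding D_def by (intro DERIV_cmult DERIV_diff der Bl LB)
    ultimately have "deriv (\<lambda>z. T f z - L f z) x = 1 / 2 * ((deriv (T h) x - deriv (T g) x) - D)"
      by (simp only: DERIV_imp_deriv)
    then have Th: "deriv (T h) x = 2 * deriv (\<lambda>z. T f z - L f z) x + deriv (T g) x + D"
      by (simp add: algebra_simps)
    have "cmod (deriv (T h) x) \<le> 2 * cmod (deriv (\<lambda>z. T f z - L f z) x) + cmod (deriv (T g) x) + cmod D"
      unfolding Th by (intro norm_triangle_mono) (simp_all add: norm_mult)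
    then have "\<mu> x * cmod (deriv (T h) x)
        \<le> \<mu> x * (2 * cmod (deriv (\<lambda>z. T f z - L f z) x) + cmod (deriv (T g) x) + cmod D)"
      using \<mu>0 by simp
    also have "\<dots> = 2 * (\<mu> x * cmod (deriv (\<lambda>z. T f z - L f z) x)) + \<mu> x * cmod (deriv (T g) x) + \<mu> x * cmod D"
      by (simp add: algebra_simps)
    \<comment> \<open>The total is exactly \<open>2 * c\<close>, which after multiplication by
      \<open>K\<close> contradicts the choice of the points.\<close>
    also have "\<dots> < 2 * N + (c - N) + (c - N)"
    proof -
      have "\<mu> x * cmod D \<le> bnorm (\<lambda>z. L h z - L g z)"
        unfolding D_def using LB x by (intro Bloch_norm_leD(2)) (simp_all add: ennreal_bnorm bnorm_nonneg)
      also have "\<dots> < c - N" unfolding h_def g_def by (rule M[OF j(1) order.refl])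
      finally show ?thesis using le_N j(2) by (simp add: x_def g_def)
    qed
    finally have "K * (\<mu> x * cmod (deriv (T h) x)) < K * (2 * c)"
      using peak_bound_pos[of n] by simp
    moreover have "2 * K * c < K * (\<mu> x * cmod (deriv (T h) x))"
      using y(2)[of "r j"] H(3)[of "r j"] by (simp add: x_def h_def)
    ultimately show False by simp
  qed
qed

lemma boundary_size_le_essential_norm:
  "boundary_size \<le> ennreal (2 * K) * essential_norm Hinf Hinf_norm (Bloch \<mu>) (Bloch_norm \<mu>) T"
  unfolding essential_norm_def
proof (rule le_ennreal_mult_INF)
  fix L assume "L \<in> {L. compact_operator Hinf Hinf_norm (Bloch \<mu>) (Bloch_norm \<mu>) L}"
  then show "boundary_size \<le> ennreal (2 * K) * dist_norm_T L"
    using limsup_A_le_dist_compact[of L] unfolding boundary_size_def by (subst Max_le_iff) auto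
qed (use peak_bound_pos[of n] in simp)

end

section \<open>Constants independent of the symbols\<close>

text \<open>Removing one order leaves three, which serve as the roots of the cubic. A finite sum
  over the four orders then gives one constant, determined by \<open>m\<close> and \<open>n\<close>
  before any symbol appears.\<close>

lemma ex_uniform_pochhammer_combination:
  fixes m n :: nat
  assumes mn: "m + 1 < n"
  defines "I \<equiv> {m, m + 1, n, n + 1}"
  obtains C :: real where "C > 0"
    "\<And>k. k \<in> I \<Longrightarrow> \<exists>d :: nat \<Rightarrow> real. (\<Sum>i=1..4. d i * pochhammer (real i) k) = 1 \<and>
      (\<forall>l\<in>I - {k}. (\<Sum>i=1..4. d i * pochhammer (real i) l) = 0) \<and>
      2 ^ k * (\<Sum>i=1..4. \<bar>d i\<bar> * 2 ^ i) \<le> C"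
proof -
  have "\<exists>d :: nat \<Rightarrow> real. (\<Sum>i=1..4. d i * pochhammer (real i) k) = 1 \<and>
      (\<forall>l\<in>I - {k}. (\<Sum>i=1..4. d i * pochhammer (real i) l) = 0)" if k: "k \<in> I" for k
  proof -
    obtain p q r where "k \<noteq> p" "k \<noteq> q" "k \<noteq> r" "I - {k} \<subseteq> {p, q, r}"
    proof -
      consider "k = m" | "k = m + 1" | "k = n" | "k = n + 1" using k unfolding I_def by auto
      then show thesis
      proof cases
        case 1 then show ?thesis using mn by (intro that[of "m + 1" n "n + 1"]) (auto simp: I_def)
      next
        case 2 then show ?thesis using mn by (intro that[of m n "n + 1"]) (auto simp: I_def)
      next
        case 3 then show ?thesis using mn by (intro that[of m "m + 1" "n + 1"]) (auto simp: I_def)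
      next
        case 4 then show ?thesis using mn by (intro that[of m "m + 1" n]) (auto simp: I_def)
      qed
    qed
    then show ?thesis using pochhammer_combination[of k p q r] by (meson subsetD)
  qed
  then have "\<forall>k\<in>I. \<exists>d :: nat \<Rightarrow> real. (\<Sum>i=1..4. d i * pochhammer (real i) k) = 1 \<and>
      (\<forall>l\<in>I - {k}. (\<Sum>i=1..4. d i * pochhammer (real i) l) = 0)" by (rule ballI)
  from bchoice[OF this] obtain d :: "nat \<Rightarrow> nat \<Rightarrow> real" where d: "\<And>k. k \<in> I \<Longrightarrow> (\<Sum>i=1..4. d k i * pochhammer (real i) k) = 1"
    "\<And>k l. k \<in> I \<Longrightarrow> l \<in> I - {k} \<Longrightarrow> (\<Sum>i=1..4. d k i * pochhammer (real i) l) = 0"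
    by blast
  define s where "s k = 2 ^ k * (\<Sum>i=1..4. \<bar>d k i\<bar> * 2 ^ i)" for k
  have s0: "s k \<ge> 0" for k unfolding s_def by (intro mult_nonneg_nonneg sum_nonneg) auto
  have fin: "finite I" by (simp add: I_def)
  show thesis
  proof (rule that)
    show "1 + (\<Sum>k\<in>I. s k) > 0" using s0 by (intro add_pos_nonneg sum_nonneg) auto
    fix k assume k: "k \<in> I"
    have "s k \<le> 1 + (\<Sum>k\<in>I. s k)"
      using member_le_sum[OF k, of s] s0 fin by (simp add: add_increasing)
    then show "\<exists>d :: nat \<Rightarrow> real. (\<Sum>i=1..4. d i * pochhammer (real i) k) = 1 \<and>
      (\<forall>l\<in>I - {k}. (\<Sum>i=1..4. d i * pochhammer (real i) l) = 0) \<and>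
      2 ^ k * (\<Sum>i=1..4. \<bar>d i\<bar> * 2 ^ i) \<le> 1 + (\<Sum>k\<in>I. s k)"
      using d[OF k] by (intro exI[of _ "d k"]) (simp add: s_def)
  qed
qed

theorem theorem4p2:
  fixes m n :: nat and \<mu> :: "complex \<Rightarrow> real"
  assumes "n \<ge> 1" and "m + 1 < n" and "radial_weight \<mu>"
  shows "\<exists>C::real. C > 0 \<and>
    (\<forall>\<psi>1 \<psi>2 \<phi>.
       \<psi>1 holomorphic_on disk \<longrightarrow> \<psi>2 holomorphic_on disk \<longrightarrow>
       \<phi> holomorphic_on disk \<longrightarrow> \<phi> ` disk \<subseteq> disk \<longrightarrow>
       bounded_operator Hinf Hinf_norm (Bloch \<mu>) (Bloch_norm \<mu>) (T_op m n \<psi>1 \<psi>2 \<phi>) \<longrightarrow>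
       comparable C
         (essential_norm Hinf Hinf_norm (Bloch \<mu>) (Bloch_norm \<mu>) (T_op m n \<psi>1 \<psi>2 \<phi>))
         (Max ((\<lambda>i. limsup_to_bdry \<phi>
                  (\<lambda>z. ennreal (\<mu> z * cmod (E_fun m n \<psi>1 \<psi>2 \<phi> i z) / (1 - (cmod (\<phi> z))\<^sup>2) ^ i)))
               ` {m, m + 1, n, n + 1})) \<and>
       comparable C
         (Max ((\<lambda>i. limsup_to_bdry \<phi>
                  (\<lambda>z. ennreal (\<mu> z * cmod (E_fun m n \<psi>1 \<psi>2 \<phi> i z) / (1 - (cmod (\<phi> z))\<^sup>2) ^ i)))
               ` {m, m + 1, n, n + 1}))
         (Max ((\<lambda>i. limsup_to_bdry \<phi>
                  (\<lambda>w. Bloch_norm \<mu> (T_op m n \<psi>1 \<psi>2 \<phi> (f_test i (\<phi> w)))))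
               ` {1..4})))"
proof -
  obtain C0 :: real where C0: "C0 > 0"
    "\<And>k. k \<in> {m, m + 1, n, n + 1} \<Longrightarrow> \<exists>d :: nat \<Rightarrow> real. (\<Sum>i=1..4. d i * pochhammer (real i) k) = 1 \<and>
      (\<forall>l\<in>{m, m + 1, n, n + 1} - {k}. (\<Sum>i=1..4. d i * pochhammer (real i) l) = 0) \<and>
      2 ^ k * (\<Sum>i=1..4. \<bar>d i\<bar> * 2 ^ i) \<le> C0"
    using ex_uniform_pochhammer_combination[OF assms(2)] by blast
  \<comment> \<open>The sum dominates the constants of all four one-sided estimates, and it is fixed
    before the symbols are introduced.\<close>
  define C where "C = C0 + 2 * peak_bound n + 3 * growth_bound m n"
  have C: "C > 0" "C0 \<le> C" "2 * peak_bound n \<le> C" "3 * growth_bound m n \<le> C" "growth_bound m n \<le> C"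
    using C0(1) peak_bound_pos[of n] growth_bound_pos[of m n] by (auto simp: C_def)
  show ?thesis
  proof (intro exI[of _ C] conjI[OF C(1)] allI impI, goal_cases)
    case (1 \<psi>1 \<psi>2 \<phi>)
    then interpret bounded_T \<mu> m n \<psi>1 \<psi>2 \<phi>
      using assms by unfold_locales auto
    have mono: "x \<le> ennreal C * y" if "x \<le> ennreal C' * y" "C' \<le> C" for x y C'
      using that(1) by (rule order.trans) (intro mult_right_mono ennreal_leI that(2), simp)
    have "comparable C (essential_norm Hinf Hinf_norm (Bloch \<mu>) (Bloch_norm \<mu>) T) boundary_size"
      using mono[OF boundary_size_le_essential_norm C(3)] mono[OF essential_norm_le C(4)]
      by (intro comparableI C(1))
    moreover have "comparable C boundary_size test_size"
      using mono[OF test_size_le C(5)] mono[OF boundary_size_le_test_size[OF C0] C(2)]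
      by (intro comparableI C(1))
    ultimately show ?case
      unfolding boundary_size_def test_size_def A_def by (rule conjI)
  qed
qed

end
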